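(* Let $k=2$ or $k=3$. Let $D=(d_{ij})_{1\le i,j\le k}$ be a real symmetric positive semidefinite matrix, let $\gamma\in[0,1]$, and assume $$|d_{ij}|\le \gamma\sqrt{d_{ii}d_{jj}}\quad\text{whenever } 1\le i,j\le k,\ i\ne j.$$ Let $\beta_{ij}=\beta_{ji}$ ($1\le i\neq j\le k$) be given real numbers and set $\beta_{ii}=-1$ ($1\le i\le k$); assume that the $k\times k$ matrix $B=(-\beta_{ij})_{1\le i,j\le k}$ is positive semidefinite. Consider the diffusion equation $$\frac{\partial u}{\partial t}=\sum_{i\ne j}d_{ij}u_{x_ix_j}+\sum_{j=1}^k d_{jj}u_{x_jx_j}$$ on $(0,1)^k$, $t>0$, with periodic boundary condition, and let $U'(t)=AU(t)+g(t)$, $A=A_0+A_1+\cdots+A_k$, be the split semidiscrete system obtained from it by the central second-order finite difference discretization with parameters $\beta_{ij}$ and the splitting described in the context. Then the ADI schemes described in the context, with parameter $\theta>0$, are unconditionally stable (in the sense defined in the context) when applied to this system for the following parameter values $\theta$: - Douglas (Do) scheme: $\theta\ge\frac12$ if $k=2$, and $\theta\ge\max\left\{\frac12,\frac{2(2\gamma+1)}{9}\right\}$ if $k=3$; - Craig--Sneyd (CS) scheme: $\theta\ge\frac12$ if $k=2$ or $k=3$; - Modified Craig--Sneyd (MCS) scheme: $\theta\ge\max\left\{\frac14,\frac{\gamma+1}{6}\right\}$ if $k=2$, and $\theta\ge\max\left\{\frac14,\frac{2(2\gamma+1)}{13}\right\}$ if $k=3$; - Hundsdorfer--Verwer (HV)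 scheme: $\theta\ge\max\left\{\frac14,\frac{\gamma+1}{4+2\sqrt2}\right\}$ if $k=2$, and $\theta\ge\max\left\{\frac14,\frac{2\gamma+1}{4+2\sqrt3}\right\}$ if $k=3$.
   Context: Sums $\sum_{i\neq j}$ run over all ordered pairs $(i,j)$ with $1\le i,j\le k$, $i\ne j$. Discretization. On a rectangular grid with constant mesh widths $\Delta x_i>0$, with multi-index $\ell=(\ell_1,\dots,\ell_k)$, unit multi-indices $e_1,\dots,e_k$, and $u_\ell=u(\ell_1\Delta x_1,\dots,\ell_k\Delta x_k,t)$, the spatial derivatives are replaced by $$(u_{x_ix_i})_\ell\approx\frac{u_{\ell+e_i}-2u_\ell+u_{\ell-e_i}}{(\Delta x_i)^2},$$ and, for $i\neq j$, $$(u_{x_ix_j})_\ell\approx\frac{(1+\beta_{ij})(u_{\ell+e_i+e_j}+u_{\ell-e_i-e_j})-(1-\beta_{ij})(u_{\ell-e_i+e_j}+u_{\ell+e_i-e_j})+\beta_{ij}\bigl(4u_\ell-2(u_{\ell+e_i}+u_{\ell+e_j}+u_{\ell-e_i}+u_{\ell-e_j})\bigr)}{4\Delta x_i\Delta x_j}.$$ In the splitting $A=A_0+A_1+\cdots+A_k$, $A_0$ represents all mixed derivative terms and $A_j$ the term $d_{jj}u_{x_jx_j}$ ($1\le j\le k$). Split $g=g_0+\cdots+g_k$ analogously and put $F(t,\xi)=A\xi+g(t)$, $F_j(t,\xi)=A_j\xi+g_j(t)$. ADI schemes. With time step $\Delta t>0$, $t_n=n\Delta t$ and parameter $\theta>0$,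 all four schemes compute $U_n$ from $U_{n-1}$ starting with $Y_0=U_{n-1}+\Delta t\,F(t_{n-1},U_{n-1})$ and $Y_j=Y_{j-1}+\theta\Delta t\,(F_j(t_n,Y_j)-F_j(t_{n-1},U_{n-1}))$ for $j=1,\dots,k$. Then: - Do: $U_n=Y_k$. - CS: $\widetilde Y_0=Y_0+\frac12\Delta t\,(F_0(t_n,Y_k)-F_0(t_{n-1},U_{n-1}))$; $\widetilde Y_j=\widetilde Y_{j-1}+\theta\Delta t\,(F_j(t_n,\widetilde Y_j)-F_j(t_{n-1},U_{n-1}))$, $1\le j\le k$; $U_n=\widetilde Y_k$. - MCS: $\widehat Y_0=Y_0+\theta\Delta t\,(F_0(t_n,Y_k)-F_0(t_{n-1},U_{n-1}))$; $\widetilde Y_0=\widehat Y_0+(\frac12-\theta)\Delta t\,(F(t_n,Y_k)-F(t_{n-1},U_{n-1}))$; $\widetilde Y_j=\widetilde Y_{j-1}+\theta\Delta t\,(F_j(t_n,\widetilde Y_j)-F_j(t_{n-1},U_{n-1}))$, $1\le j\le k$; $U_n=\widetilde Y_k$. - HV: $\widetilde Y_0=Y_0+\frac12\Delta t\,(F(t_n,Y_k)-F(t_{n-1},U_{n-1}))$; $\widetilde Y_j=\widetilde Y_{j-1}+\theta\Delta t\,(F_j(t_n,\widetilde Y_j)-F_j(t_n,Y_k))$, $1\le j\le k$; $U_n=\widetilde Y_k$. Stability functions. Applied to the scalar test equation $U'=(\lambda_0+\cdots+\lambda_k)U$, with $z_j=\Delta t\,\lambda_j$, each scheme gives $U_n=M(z_0,\dots,z_k)U_{n-1}$.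 With $z=z_1+\cdots+z_k$ and $p=\prod_{j=1}^k(1-\theta z_j)$: - Do: $M=1+\frac{z_0+z}{p}$. - CS: $M=1+\frac{z_0+z}{p}+\frac12\frac{z_0(z_0+z)}{p^2}$. - MCS: $M=1+\frac{z_0+z}{p}+\theta\frac{z_0(z_0+z)}{p^2}+\left(\frac12-\theta\right)\frac{(z_0+z)^2}{p^2}$. - HV: $M=1+2\frac{z_0+z}{p}-\frac{z_0+z}{p^2}+\frac12\frac{(z_0+z)^2}{p^2}$. Unconditional stability. Stability is in the von Neumann ($l_2$) sense. With periodic boundary condition the matrices $A_0,\dots,A_k$ are normal and commuting, and their eigenvalues scaled by $\Delta t$ are $$z_0=\sum_{i\ne j}r_{ij}d_{ij}\bigl[-\sin\phi_i\sin\phi_j+\beta_{ij}(1-\cos\phi_i)(1-\cos\phi_j)\bigr],\qquad z_j=-2r_{jj}d_{jj}(1-\cos\phi_j)\ (1\le j\le k),$$ where $r_{ij}=\Delta t/(\Delta x_i\Delta x_j)$ and each $\phi_j$ is an integer multiple of $2\pi/m_j$, $m_j\ge1$ being the number of grid points in the $x_j$-direction. The scheme is called unconditionally stable if $|M(z_0,z_1,\dots,z_k)|\le1$ for all such $(z_0,\dots,z_k)$, for all $\Delta t>0$, all $\Delta x_i>0$ ($1\le i\le k$), all grid dimensions $m_j$ and all corresponding angles $\phi_j$. *)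

theory Defs
  imports "HOL-Analysis.Analysis"
begin

section \<open>Semidiscretization on a periodic grid\<close>

text \<open>
  The index type \<open>'n\<close> stands for the spatial directions, so \<open>k = CARD('n)\<close>; multi-indices are
  vectors \<open>l :: int^'n\<close>, and the unit multi-index \<open>e\<^sub>i\<close> is \<open>axis i 1\<close>. A grid function on a
  periodic grid with \<open>m $ j\<close> points in direction \<open>j\<close> is represented by its periodic extension
  to all multi-indices. Values are complex because eigenvectors are.
\<close>

definition psd :: "real^'n^'n \<Rightarrow> bool" where
  "psd M \<longleftrightarrow> (\<forall>x. 0 \<le> x \<bullet> (M *v x))"

definition periodic_grid_function :: "nat^'n \<Rightarrow> (int^'n \<Rightarrow> complex) \<Rightarrow> bool" where
  "periodic_grid_function m u \<longleftrightarrow> (\<forall>j l. u (l + axis j (int (m $ j))) = u l)"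

definition diff2 :: "real^'n \<Rightarrow> 'n \<Rightarrow> (int^'n \<Rightarrow> complex) \<Rightarrow> int^'n \<Rightarrow> complex" where
  "diff2 h i u l = (u (l + axis i 1) - 2 * u l + u (l - axis i 1)) / of_real ((h $ i)\<^sup>2)"

definition diff_mixed ::
  "real^'n \<Rightarrow> real \<Rightarrow> 'n \<Rightarrow> 'n \<Rightarrow> (int^'n \<Rightarrow> complex) \<Rightarrow> int^'n \<Rightarrow> complex" where
  "diff_mixed h b i j u l =
     (of_real (1 + b) * (u (l + axis i 1 + axis j 1) + u (l - axis i 1 - axis j 1))
      - of_real (1 - b) * (u (l - axis i 1 + axis j 1) + u (l + axis i 1 - axis j 1))
      + of_real b * (4 * u l - 2 * (u (l + axis i 1) + u (l + axis j 1)
                                    + u (l - axis i 1) + u (l - axis j 1))))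
     / of_real (4 * h $ i * h $ j)"

definition A_mixed ::
  "real^'n^'n \<Rightarrow> real^'n^'n \<Rightarrow> real^'n \<Rightarrow> (int^'n \<Rightarrow> complex) \<Rightarrow> int^'n \<Rightarrow> complex" where
  "A_mixed D \<beta> h u l =
     (\<Sum>i\<in>UNIV. \<Sum>j\<in>UNIV - {i}. of_real (D $ i $ j) * diff_mixed h (\<beta> $ i $ j) i j u l)"

definition A_dir ::
  "real^'n^'n \<Rightarrow> real^'n \<Rightarrow> 'n \<Rightarrow> (int^'n \<Rightarrow> complex) \<Rightarrow> int^'n \<Rightarrow> complex" where
  "A_dir D h j u l = of_real (D $ j $ j) * diff2 h j u l"

text \<open>
  \<open>\<mu>0\<close> and \<open>\<mu> j\<close> are the eigenvalues of \<open>A\<^sub>0\<close> and of the \<open>A\<^sub>j\<close> for one common eigenvector.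
  These matrices are normal and commute, so such tuples are exactly the ones occurring in a
  simultaneous diagonalization.
\<close>

definition joint_eigenvalues ::
  "real^'n^'n \<Rightarrow> real^'n^'n \<Rightarrow> real^'n \<Rightarrow> nat^'n \<Rightarrow> complex \<Rightarrow> ('n \<Rightarrow> complex) \<Rightarrow> bool" where
  "joint_eigenvalues D \<beta> h m \<mu>0 \<mu> \<longleftrightarrow>
     (\<exists>v. periodic_grid_function m v \<and> v \<noteq> (\<lambda>l. 0) \<and>
          A_mixed D \<beta> h v = (\<lambda>l. \<mu>0 * v l) \<and> (\<forall>j. A_dir D h j v = (\<lambda>l. \<mu> j * v l)))"


section \<open>ADI schemes\<close>

datatype adi_scheme = Douglas | Craig_Sneyd | Modified_Craig_Sneyd | Hundsdorfer_Verwer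

text \<open>
  A state is a function on an arbitrary set of points \<open>'p\<close> (one point for a scalar equation,
  the multi-indices for the semidiscrete system). The relation below describes the implicit stages
  \<open>Y\<^sub>j = Y\<^sub>j\<^sub>-\<^sub>1 + s (F j Y\<^sub>j - G j)\<close>, with \<open>j\<close> running through the given list of directions;
  it leads from the initial to the final stage.
\<close>

primrec implicit_stages ::
  "real \<Rightarrow> ('n \<Rightarrow> ('p \<Rightarrow> complex) \<Rightarrow> 'p \<Rightarrow> complex) \<Rightarrow> ('n \<Rightarrow> 'p \<Rightarrow> complex) \<Rightarrow> 'n list \<Rightarrow>
   ('p \<Rightarrow> complex) \<Rightarrow> ('p \<Rightarrow> complex) \<Rightarrow> bool" where
  "implicit_stages s F G [] Y Z \<longleftrightarrow> Z = Y"
| "implicit_stages s F G (j # js) Y Z \<longleftrightarrow>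
     (\<exists>Y'. Y' = (\<lambda>x. Y x + of_real s * (F j Y' x - G j x)) \<and> implicit_stages s F G js Y' Z)"

text \<open>
  One step from \<open>U\<close> at time \<open>t\<close> to \<open>V\<close> at time \<open>t + \<Delta>t\<close>, for the splitting
  \<open>F0 + (\<Sum>j. F j)\<close>; the list \<open>js\<close> enumerates the directions in the order in which they are
  treated.
\<close>

definition adi_step ::
  "adi_scheme \<Rightarrow> real \<Rightarrow> real \<Rightarrow> 'n::finite list \<Rightarrow>
   (real \<Rightarrow> ('p \<Rightarrow> complex) \<Rightarrow> 'p \<Rightarrow> complex) \<Rightarrow>
   ('n \<Rightarrow> real \<Rightarrow> ('p \<Rightarrow> complex) \<Rightarrow> 'p \<Rightarrow> complex) \<Rightarrow>
   real \<Rightarrow> ('p \<Rightarrow> complex) \<Rightarrow> ('p \<Rightarrow> complex) \<Rightarrow> bool" where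
  "adi_step sch \<theta> \<Delta>t js F0 F t U V \<longleftrightarrow>
    (let t' = t + \<Delta>t;
         FF = (\<lambda>\<tau> \<xi> x. F0 \<tau> \<xi> x + (\<Sum>j\<in>UNIV. F j \<tau> \<xi> x));
         stages = (\<lambda>G. implicit_stages (\<theta> * \<Delta>t) (\<lambda>j. F j t') G js);
         old = (\<lambda>j. F j t U);
         Y0 = (\<lambda>x. U x + of_real \<Delta>t * FF t U x)
     in \<exists>Y. stages old Y0 Y \<and>
       (case sch of
          Douglas \<Rightarrow> V = Y
        | Craig_Sneyd \<Rightarrow>
            stages old (\<lambda>x. Y0 x + of_real (\<Delta>t / 2) * (F0 t' Y x - F0 t U x)) V
        | Modified_Craig_Sneyd \<Rightarrow>
            stages old (\<lambda>x. Y0 x + of_real (\<theta> * \<Delta>t) * (F0 t' Y x - F0 t U x)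
                                 + of_real ((1/2 - \<theta>) * \<Delta>t) * (FF t' Y x - FF t U x)) V
        | Hundsdorfer_Verwer \<Rightarrow>
            stages (\<lambda>j. F j t' Y)
              (\<lambda>x. Y0 x + of_real (\<Delta>t / 2) * (FF t' Y x - FF t U x)) V))"

definition stability_function ::
  "adi_scheme \<Rightarrow> real \<Rightarrow> complex \<Rightarrow> ('n::finite \<Rightarrow> complex) \<Rightarrow> complex" where
  "stability_function sch \<theta> z0 zs =
    (let z = (\<Sum>j\<in>UNIV. zs j);
         p = (\<Prod>j\<in>UNIV. 1 - of_real \<theta> * zs j)
     in case sch of
          Douglas \<Rightarrow> 1 + (z0 + z) / p
        | Craig_Sneyd \<Rightarrow> 1 + (z0 + z) / p + 1/2 * (z0 * (z0 + z) / p\<^sup>2)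
        | Modified_Craig_Sneyd \<Rightarrow>
            1 + (z0 + z) / p + of_real \<theta> * (z0 * (z0 + z) / p\<^sup>2)
              + (1/2 - of_real \<theta>) * ((z0 + z)\<^sup>2 / p\<^sup>2)
        | Hundsdorfer_Verwer \<Rightarrow>
            1 + 2 * ((z0 + z) / p) - (z0 + z) / p\<^sup>2 + 1/2 * ((z0 + z)\<^sup>2 / p\<^sup>2))"

lemma implicit_stages_test:
  assumes "\<And>j. j \<in> set js \<Longrightarrow> 1 - of_real s * \<mu> j \<noteq> (0::complex)"
  shows "implicit_stages s (\<lambda>j \<xi> x. \<mu> j * \<xi> x) (\<lambda>j x. \<mu> j * W x) js Y Z \<longleftrightarrow>
         Z = (\<lambda>x. W x + (Y x - W x) / (\<Prod>j\<leftarrow>js. 1 - of_real s * \<mu> j))"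
  using assms
proof (induction js arbitrary: Y)
  case (Cons j js)
  let ?c = "1 - of_real s * \<mu> j"
  have c: "?c \<noteq> 0" using Cons.prems by simp
  have solve: "Y' = (\<lambda>x. Y x + of_real s * (\<mu> j * Y' x - \<mu> j * W x)) \<longleftrightarrow>
      Y' = (\<lambda>x. W x + (Y x - W x) / ?c)" for Y'
  proof -
    have "a = y + of_real s * (\<mu> j * a - \<mu> j * w) \<longleftrightarrow> a = w + (y - w) / ?c" for a y w :: complex
      using c by (simp add: field_simps)
    then show ?thesis by (simp add: fun_eq_iff)
  qed
  show ?case
    unfolding implicit_stages.simps solve using Cons by (simp add: divide_divide_eq_left)
qed simp

text \<open>The stability functions are the amplification factors for the scalar test equation.\<close>

theorem adi_step_test_equation:
  fixes \<mu> :: "'n::finite \<Rightarrow> complex" and U V :: "'p \<Rightarrow> complex"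
  assumes js: "distinct js" "set js = UNIV"
    and nz: "\<And>j. 1 - of_real (\<theta> * \<Delta>t) * \<mu> j \<noteq> 0"
  shows "adi_step sch \<theta> \<Delta>t js (\<lambda>\<tau> \<xi> x. \<mu>0 * \<xi> x) (\<lambda>j \<tau> \<xi> x. \<mu> j * \<xi> x) t U V \<longleftrightarrow>
    V = (\<lambda>x. stability_function sch \<theta> (of_real \<Delta>t * \<mu>0) (\<lambda>j. of_real \<Delta>t * \<mu> j) * U x)"
proof -
  define p where "p = (\<Prod>j\<in>UNIV. 1 - of_real (\<theta> * \<Delta>t) * \<mu> j)"
  have p: "(\<Prod>j\<leftarrow>js. 1 - of_real (\<theta> * \<Delta>t) * \<mu> j) = p"
    unfolding p_def using js by (metis prod.distinct_set_conv_list)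
  have p': "(\<Prod>j\<in>UNIV. 1 - of_real \<theta> * (of_real \<Delta>t * \<mu> j)) = p"
    by (simp add: p_def mult.assoc)
  have p0: "p \<noteq> 0" using nz by (simp add: p_def)
  note st = implicit_stages_test[where s = "\<theta> * \<Delta>t" and \<mu> = \<mu> and js = js, OF nz, unfolded p]
  have sm: "(\<Sum>j\<in>UNIV. \<mu> j * a) = (\<Sum>j\<in>UNIV. \<mu> j) * a" for a :: complex
    by (simp add: sum_distrib_right)
  have sm': "(\<Sum>j\<in>UNIV. of_real \<Delta>t * \<mu> j) = of_real \<Delta>t * (\<Sum>j\<in>UNIV. \<mu> j)"
    by (simp add: sum_distrib_left)
  show ?thesis
    unfolding adi_step_def stability_function_def Let_def st sm sm' p'
    using p0
    by (cases sch; simp only: adi_scheme.case simp_thms;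
        intro arg_cong[where f = "\<lambda>f. V = f"] ext;
        simp add: divide_simps power2_eq_square; simp add: algebra_simps)
qed


lemma diff_shift_combination:
  fixes v :: "int^'n \<Rightarrow> complex" and c :: "nat \<Rightarrow> complex"
  shows A_mixed_shift_combination:
      "A_mixed D \<beta> h (\<lambda>l. \<Sum>p<N. c p * v (l + a p)) l = (\<Sum>p<N. c p * A_mixed D \<beta> h v (l + a p))"
    and A_dir_shift_combination:
      "A_dir D h j (\<lambda>l. \<Sum>p<N. c p * v (l + a p)) l = (\<Sum>p<N. c p * A_dir D h j v (l + a p))"
proof -
  have sh: "l + x + a p = l + a p + x" "l - x + a p = l + a p - x" for l x p
    by (simp_all add: algebra_simps)
  have m: "diff_mixed h b i j (\<lambda>l. \<Sum>p<N. c p * v (l + a p)) l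
      = (\<Sum>p<N. c p * diff_mixed h b i j v (l + a p))" for b i j
    unfolding diff_mixed_def sh
    by (simp add: sum_distrib_left sum_divide_distrib sum.distrib sum_subtractf algebra_simps
        add_divide_distrib diff_divide_distrib)
  show "A_mixed D \<beta> h (\<lambda>l. \<Sum>p<N. c p * v (l + a p)) l
      = (\<Sum>p<N. c p * A_mixed D \<beta> h v (l + a p))"
    unfolding A_mixed_def m sum_distrib_left
    by (subst sum.swap, subst (2) sum.swap)
       (intro sum.cong refl, simp add: mult.left_commute sum.swap)
  show "A_dir D h j (\<lambda>l. \<Sum>p<N. c p * v (l + a p)) l
      = (\<Sum>p<N. c p * A_dir D h j v (l + a p))"
    unfolding A_dir_def diff2_def sh
    by (simp add: sum_distrib_left sum_divide_distrib sum.distrib sum_subtractf algebra_simps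
        add_divide_distrib diff_divide_distrib)
qed

text \<open>
  On a common eigenvector, a step for the (homogeneous) semidiscrete system reduces to a step for
  the scalar test equation, here posed on the one-point set \<open>unit\<close>.
\<close>

lemma implicit_stages_eigenvector:
  assumes "\<And>j c. F j (\<lambda>l. c * v l) = (\<lambda>l. \<mu> j * c * v l)"
    and "implicit_stages s (\<lambda>j \<xi> x. \<mu> j * \<xi> x) G js Y (Z :: unit \<Rightarrow> complex)"
  shows "implicit_stages s F (\<lambda>j l. G j () * v l) js (\<lambda>l. Y () * v l) (\<lambda>l. Z () * v l)"
  using assms(2)
proof (induction js arbitrary: Y)
  case (Cons j js)
  then obtain Y' where Y': "Y' = (\<lambda>x. Y x + of_real s * (\<mu> j * Y' x - G j x))"
    and "implicit_stages s (\<lambda>j \<xi> x. \<mu> j * \<xi> x) G js Y' Z" by auto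
  then have "implicit_stages s F (\<lambda>j l. G j () * v l) js (\<lambda>l. Y' () * v l) (\<lambda>l. Z () * v l)"
    using Cons.IH by blast
  moreover have "(\<lambda>l. Y' () * v l) =
      (\<lambda>l. Y () * v l + of_real s * (F j (\<lambda>l. Y' () * v l) l - G j () * v l))"
  proof
    fix l
    have "Y' () * v l = (Y () + of_real s * (\<mu> j * Y' () - G j ())) * v l"
      using fun_cong[OF Y', of "()"] by (rule arg_cong)
    then show "Y' () * v l =
        Y () * v l + of_real s * (F j (\<lambda>l. Y' () * v l) l - G j () * v l)"
      unfolding assms(1) by (simp add: algebra_simps)
  qed
  ultimately show ?case by auto
qed simp

theorem adi_step_semidiscrete_eigenvector:
  assumes js: "distinct js" "set js = UNIV"
    and nz: "\<And>j. 1 - of_real (\<theta> * \<Delta>t) * \<mu> j \<noteq> 0"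
    and e0: "A_mixed D \<beta> h v = (\<lambda>l. \<mu>0 * v l)"
    and e: "\<And>j. A_dir D h j v = (\<lambda>l. \<mu> j * v l)"
  shows "adi_step sch \<theta> \<Delta>t js (\<lambda>\<tau>. A_mixed D \<beta> h) (\<lambda>j \<tau>. A_dir D h j) t v
    (\<lambda>l. stability_function sch \<theta> (of_real \<Delta>t * \<mu>0) (\<lambda>j. of_real \<Delta>t * \<mu> j) * v l)"
proof -
  define M where "M = stability_function sch \<theta> (of_real \<Delta>t * \<mu>0) (\<lambda>j. of_real \<Delta>t * \<mu> j)"
  have E0: "A_mixed D \<beta> h (\<lambda>l. c * v l) = (\<lambda>l. \<mu>0 * c * v l)" for c
    using A_mixed_shift_combination[where N = 1 and c = "\<lambda>p. c" and a = "\<lambda>p. 0" and v = v]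
    by (simp add: e0 mult_ac fun_eq_iff)
  have E: "A_dir D h j (\<lambda>l. c * v l) = (\<lambda>l. \<mu> j * c * v l)" for c j
    using A_dir_shift_combination[where N = 1 and c = "\<lambda>p. c" and a = "\<lambda>p. 0" and v = v]
    by (simp add: e mult_ac fun_eq_iff)
  note transfer = implicit_stages_eigenvector[where F = "A_dir D h" and v = v and \<mu> = \<mu>, OF E]
  have step: "adi_step sch \<theta> \<Delta>t js (\<lambda>\<tau> \<xi> x. \<mu>0 * \<xi> x) (\<lambda>j \<tau> \<xi> x. \<mu> j * \<xi> x) t
      (\<lambda>x::unit. 1) (\<lambda>x. M)"
    unfolding adi_step_test_equation[OF js nz] M_def by simp
  let ?init = "\<lambda>x::unit. 1 + of_real \<Delta>t * (\<mu>0 + (\<Sum>j\<in>UNIV. \<mu> j))"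
  obtain Y where
    "implicit_stages (\<theta> * \<Delta>t) (\<lambda>j \<xi> x. \<mu> j * \<xi> x) (\<lambda>j x. \<mu> j) js ?init Y"
    and Y2: "case sch of
          Douglas \<Rightarrow> (\<lambda>x. M) = Y
        | Craig_Sneyd \<Rightarrow> implicit_stages (\<theta> * \<Delta>t) (\<lambda>j \<xi> x. \<mu> j * \<xi> x) (\<lambda>j x. \<mu> j) js
            (\<lambda>x. ?init x + of_real (\<Delta>t / 2) * (\<mu>0 * Y x - \<mu>0)) (\<lambda>x. M)
        | Modified_Craig_Sneyd \<Rightarrow> implicit_stages (\<theta> * \<Delta>t) (\<lambda>j \<xi> x. \<mu> j * \<xi> x) (\<lambda>j x. \<mu> j) js
            (\<lambda>x. ?init x + of_real (\<theta> * \<Delta>t) * (\<mu>0 * Y x - \<mu>0)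
               + of_real ((1/2 - \<theta>) * \<Delta>t)
                 * (\<mu>0 * Y x + (\<Sum>j\<in>UNIV. \<mu> j * Y x) - (\<mu>0 + (\<Sum>j\<in>UNIV. \<mu> j)))) (\<lambda>x. M)
        | Hundsdorfer_Verwer \<Rightarrow>
            implicit_stages (\<theta> * \<Delta>t) (\<lambda>j \<xi> x. \<mu> j * \<xi> x) (\<lambda>j x. \<mu> j * Y x) js
              (\<lambda>x. ?init x + of_real (\<Delta>t / 2)
                 * (\<mu>0 * Y x + (\<Sum>j\<in>UNIV. \<mu> j * Y x) - (\<mu>0 + (\<Sum>j\<in>UNIV. \<mu> j)))) (\<lambda>x. M)"
    using step unfolding adi_step_def Let_def mult_1_right by (elim exE conjE) (rule that)
  have Y1: "implicit_stages (\<theta> * \<Delta>t) (A_dir D h) (\<lambda>j l. \<mu> j * v l) js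
      (\<lambda>l. ?init () * v l) (\<lambda>l. Y () * v l)"
    by (rule transfer) fact
  have start: "v l + of_real \<Delta>t * (\<mu>0 * v l + (\<Sum>j\<in>UNIV. \<mu> j * v l)) = ?init () * v l" for l
    by (simp add: algebra_simps sum_distrib_left sum_distrib_right)
  have T: "implicit_stages (\<theta> * \<Delta>t) (A_dir D h) G' js A (\<lambda>l. M * v l)"
    if "implicit_stages (\<theta> * \<Delta>t) (\<lambda>j \<xi> x. \<mu> j * \<xi> x) G js X (\<lambda>x::unit. M)"
      "G' = (\<lambda>j l. G j () * v l)" "A = (\<lambda>l. X () * v l)" for G G' X A
    using transfer[OF that(1)] that(2,3) by simp
  have S: "(\<Sum>j\<in>UNIV. \<mu> j * a) = (\<Sum>j\<in>UNIV. \<mu> j) * a"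
    "(\<Sum>j\<in>UNIV. \<mu> j * a * b) = (\<Sum>j\<in>UNIV. \<mu> j) * a * b" for a b
    by (simp_all add: sum_distrib_right)
  have Y3: "case sch of
      Douglas \<Rightarrow> (\<lambda>l. M * v l) = (\<lambda>l. Y () * v l)
    | Craig_Sneyd \<Rightarrow>
        implicit_stages (\<theta> * \<Delta>t) (A_dir D h) (\<lambda>j l. \<mu> j * v l) js
          (\<lambda>l. ?init () * v l + of_real (\<Delta>t / 2) * (\<mu>0 * Y () * v l - \<mu>0 * v l)) (\<lambda>l. M * v l)
    | Modified_Craig_Sneyd \<Rightarrow>
        implicit_stages (\<theta> * \<Delta>t) (A_dir D h) (\<lambda>j l. \<mu> j * v l) js
          (\<lambda>l. ?init () * v l + of_real (\<theta> * \<Delta>t) * (\<mu>0 * Y () * v l - \<mu>0 * v l)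
            + of_real ((1/2 - \<theta>) * \<Delta>t) * (\<mu>0 * Y () * v l + (\<Sum>j\<in>UNIV. \<mu> j * Y () * v l)
                - (\<mu>0 * v l + (\<Sum>j\<in>UNIV. \<mu> j * v l)))) (\<lambda>l. M * v l)
    | Hundsdorfer_Verwer \<Rightarrow>
        implicit_stages (\<theta> * \<Delta>t) (A_dir D h) (\<lambda>j l. \<mu> j * Y () * v l) js
          (\<lambda>l. ?init () * v l
            + of_real (\<Delta>t / 2) * (\<mu>0 * Y () * v l + (\<Sum>j\<in>UNIV. \<mu> j * Y () * v l)
                - (\<mu>0 * v l + (\<Sum>j\<in>UNIV. \<mu> j * v l)))) (\<lambda>l. M * v l)"
  proof (cases sch)
    case Douglas
    then show ?thesis using Y2 by (auto dest: fun_cong[of _ _ "()"])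
  next
    case Craig_Sneyd
    show ?thesis unfolding Craig_Sneyd adi_scheme.case
      by (rule T[OF Y2[unfolded Craig_Sneyd adi_scheme.case]])
        (simp_all add: fun_eq_iff field_simps)
  next
    case Modified_Craig_Sneyd
    show ?thesis unfolding Modified_Craig_Sneyd adi_scheme.case
      by (rule T[OF Y2[unfolded Modified_Craig_Sneyd adi_scheme.case]])
        (simp_all only: S fun_eq_iff, simp_all add: field_simps)
  next
    case Hundsdorfer_Verwer
    show ?thesis unfolding Hundsdorfer_Verwer adi_scheme.case
      by (rule T[OF Y2[unfolded Hundsdorfer_Verwer adi_scheme.case]])
        (simp_all only: S fun_eq_iff, simp_all add: field_simps)
  qed
  show ?thesis
    unfolding M_def[symmetric] adi_step_def Let_def e0 e start
    by (intro exI[of _ "\<lambda>l. Y () * v l"] conjI, fact Y1, unfold E0 E, fact Y3)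
qed


section \<open>Unconditional stability\<close>

definition unconditionally_stable ::
  "adi_scheme \<Rightarrow> real \<Rightarrow> real^'n^'n \<Rightarrow> real^'n^'n \<Rightarrow> bool" where
  "unconditionally_stable sch \<theta> D \<beta> \<longleftrightarrow>
    (\<forall>\<Delta>t h m \<mu>0 \<mu>.
       \<Delta>t > 0 \<longrightarrow> (\<forall>i. h $ i > 0) \<longrightarrow> (\<forall>j. m $ j \<ge> 1) \<longrightarrow> joint_eigenvalues D \<beta> h m \<mu>0 \<mu> \<longrightarrow>
       cmod (stability_function sch \<theta> (of_real \<Delta>t * \<mu>0) (\<lambda>j. of_real \<Delta>t * \<mu> j)) \<le> 1)"

text \<open>
  The remainder of this theory computes the eigenvalues and thereby expresses unconditional
  stability through the grid angles \<open>\<phi> j\<close>.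
\<close>

definition grid_angles :: "nat^'n \<Rightarrow> ('n \<Rightarrow> real) \<Rightarrow> bool" where
  "grid_angles m \<phi> \<longleftrightarrow> (\<forall>j. \<exists>q::int. \<phi> j = of_int q * (2 * pi / real (m $ j)))"

definition scaled_eigenvalue_mixed ::
  "real^'n^'n \<Rightarrow> real^'n^'n \<Rightarrow> real \<Rightarrow> real^'n \<Rightarrow> ('n \<Rightarrow> real) \<Rightarrow> real" where
  "scaled_eigenvalue_mixed D \<beta> \<Delta>t h \<phi> =
     (\<Sum>i\<in>UNIV. \<Sum>j\<in>UNIV - {i}. \<Delta>t / (h $ i * h $ j) * D $ i $ j *
        (- sin (\<phi> i) * sin (\<phi> j) + \<beta> $ i $ j * (1 - cos (\<phi> i)) * (1 - cos (\<phi> j))))"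

definition scaled_eigenvalue_dir ::
  "real^'n^'n \<Rightarrow> real \<Rightarrow> real^'n \<Rightarrow> ('n \<Rightarrow> real) \<Rightarrow> 'n \<Rightarrow> real" where
  "scaled_eigenvalue_dir D \<Delta>t h \<phi> j =
     - 2 * (\<Delta>t / (h $ j * h $ j)) * D $ j $ j * (1 - cos (\<phi> j))"


lemma fourier_mode:
  fixes v :: "int^'n \<Rightarrow> complex"
  assumes v: "\<And>j l. v (l + axis j 1) = cis (\<phi> j) * v l"
  shows fourier_mode_mixed:
      "of_real \<Delta>t * A_mixed D \<beta> h v l = of_real (scaled_eigenvalue_mixed D \<beta> \<Delta>t h \<phi>) * v l"
    and fourier_mode_dir:
      "of_real \<Delta>t * A_dir D h j v l = of_real (scaled_eigenvalue_dir D \<Delta>t h \<phi> j) * v l"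
proof -
  have v': "v (l - axis j 1) = cis (- \<phi> j) * v l" for j l
    using v[of "l - axis j 1" j] by (simp add: mult.assoc[symmetric] cis_mult)
  have c: "cis x = of_real (cos x) + \<i> * of_real (sin x)" for x
    by (simp add: complex_eq_iff)
  have vmp: "v (l - axis i 1 + axis j 1) = cis (\<phi> j) * (cis (- \<phi> i) * v l)" for i j
    by (simp only: v v')
  have vmm: "v (l - axis i 1 - axis j 1) = cis (- \<phi> j) * (cis (- \<phi> i) * v l)" for i j
    by (simp only: v v')
  have vpm: "v (l + axis i 1 - axis j 1) = cis (- \<phi> j) * (cis (\<phi> i) * v l)" for i j
    by (simp only: v v')
  have vpp: "v (l + axis i 1 + axis j 1) = cis (\<phi> j) * (cis (\<phi> i) * v l)" for i j
    by (simp only: v v')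
  have mixed: "diff_mixed h b i j v l =
      of_real ((- sin (\<phi> i) * sin (\<phi> j) + b * (1 - cos (\<phi> i)) * (1 - cos (\<phi> j)))
               / (h $ i * h $ j)) * v l" for b i j
  proof -
    have "of_real (1 + b) * (v (l + axis i 1 + axis j 1) + v (l - axis i 1 - axis j 1))
      - of_real (1 - b) * (v (l - axis i 1 + axis j 1) + v (l + axis i 1 - axis j 1))
      + of_real b * (4 * v l - 2 * (v (l + axis i 1) + v (l + axis j 1)
                                    + v (l - axis i 1) + v (l - axis j 1)))
      = of_real (4 * (- sin (\<phi> i) * sin (\<phi> j) + b * (1 - cos (\<phi> i)) * (1 - cos (\<phi> j)))) * v l"
      unfolding vpp vmm vmp vpm unfolding v v' c
      by (simp add: algebra_simps) 
    moreover have "of_real (4 * x) * w / of_real (4 * h $ i * h $ j)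
      = of_real (x / (h $ i * h $ j)) * w" for x and w :: complex by simp
    ultimately show ?thesis
      unfolding diff_mixed_def by (simp only:)
  qed
  show "of_real \<Delta>t * A_mixed D \<beta> h v l =
      of_real (scaled_eigenvalue_mixed D \<beta> \<Delta>t h \<phi>) * v l"
    unfolding A_mixed_def scaled_eigenvalue_mixed_def mixed of_real_sum sum_distrib_left
      sum_distrib_right
    by (intro sum.cong refl) simp
  have "v (l + axis j 1) - 2 * v l + v (l - axis j 1) = of_real (- 2 * (1 - cos (\<phi> j))) * v l"
    unfolding v v' c by (simp add: algebra_simps)
  then show "of_real \<Delta>t * A_dir D h j v l =
      of_real (scaled_eigenvalue_dir D \<Delta>t h \<phi> j) * v l"
    unfolding A_dir_def scaled_eigenvalue_dir_def diff2_def
    by (simp add: power2_eq_square algebra_simps diff_divide_distrib)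
qed

lemma sum_roots_of_unity_powers:
  assumes "p < N"
  shows "(\<Sum>q<N. cis (2 * pi * real q / real N) ^ p) = (if p = 0 then of_nat N else 0)"
proof (cases "p = 0")
  case False
  define z where "z = cis (2 * pi * real p / real N)"
  have N: "N > 0" using assms by simp
  note bij = Complex.bij_betw_roots_unity[OF N]
  have "z \<noteq> cis (2 * pi * real 0 / real N)"
    using bij_betw_imp_inj_on[OF bij] assms N False unfolding z_def inj_on_def by blast
  then have z1: "z \<noteq> 1" by simp
  have zN: "z ^ N = 1" using bij_betw_apply[OF bij, of p] assms by (simp add: z_def)
  have "(\<Sum>q<N. cis (2 * pi * real q / real N) ^ p) = (\<Sum>q<N. z ^ q)"
    by (intro sum.cong refl) (simp only: z_def Complex.DeMoivre, rule arg_cong[where f = cis], simp)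
  also have "\<dots> = 0" using geometric_sum[OF z1] zN by simp
  finally show ?thesis using False by simp
qed simp

lemma periodic_projection:
  fixes v :: "int^'n \<Rightarrow> complex"
  assumes m: "m $ i \<ge> 1" and per: "periodic_grid_function m v" and nz: "v \<noteq> (\<lambda>l. 0)"
    and e0: "A_mixed D \<beta> h v = (\<lambda>l. \<mu>0 * v l)"
    and e: "\<And>j. A_dir D h j v = (\<lambda>l. \<mu> j * v l)"
  obtains q :: int and w where "periodic_grid_function m w" "w \<noteq> (\<lambda>l. 0)"
    "A_mixed D \<beta> h w = (\<lambda>l. \<mu>0 * w l)" "\<And>j. A_dir D h j w = (\<lambda>l. \<mu> j * w l)"
    "\<And>l. w (l + axis i 1) = cis (of_int q * (2 * pi / real (m $ i))) * w l"
    "\<forall>j c. (\<forall>l. v (l + axis j 1) = c * v l) \<longrightarrow> (\<forall>l. w (l + axis j 1) = c * w l)"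
proof -
  define N where "N = m $ i"
  define \<xi> where "\<xi> q = cis (2 * pi * real q / real N)" for q :: nat
  define W where "W q l = (\<Sum>p<N. \<xi> q ^ p * v (l + axis i (int p)))" for q l
  have N: "N > 0" using m by (simp add: N_def)
  have "\<exists>q. W q \<noteq> (\<lambda>l. 0)"
  proof (rule ccontr)
    assume "\<not> ?thesis"
    then have W0: "W q l = 0" for q l by (auto simp: fun_eq_iff)
    have "v l = 0" for l
    proof -
      have "(\<Sum>q<N. W q l) = (\<Sum>p<N. (\<Sum>q<N. \<xi> q ^ p) * v (l + axis i (int p)))"
        unfolding W_def by (subst sum.swap) (simp add: sum_distrib_right)
      also have "\<dots> = (\<Sum>p<N. if p = 0 then of_nat N * v (l + axis i (int p)) else 0)"
        by (intro sum.cong refl) (simp add: \<xi>_def sum_roots_of_unity_powers)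
      also have "\<dots> = of_nat N * v l"
        using N by (simp add: axis_def zero_vec_def[symmetric])
      finally show ?thesis using W0 N by simp
    qed
    then show False using nz by auto
  qed
  then obtain q where q: "W q \<noteq> (\<lambda>l. 0)" by blast
  have W: "W q = (\<lambda>l. \<Sum>p<N. \<xi> q ^ p * v (l + axis i (int p)))" by (simp add: W_def fun_eq_iff)
  have sh: "l + x + axis i (int p) = l + axis i (int p) + x" for l x :: "int^'n" and p
    by (simp add: algebra_simps)
  show ?thesis
  proof (rule that[of "W q" "- int q"])
    show "periodic_grid_function m (W q)"
      using per unfolding periodic_grid_function_def W sh by simp
    show "W q \<noteq> (\<lambda>l. 0)" by (fact q)
    show "A_mixed D \<beta> h (W q) = (\<lambda>l. \<mu>0 * W q l)"
      unfolding W
      by (rule ext, subst A_mixed_shift_combination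
            [where v = v and c = "\<lambda>p. \<xi> q ^ p" and a = "\<lambda>p. axis i (int p)"])
         (simp add: e0 sum_distrib_left mult_ac)
    show "A_dir D h j (W q) = (\<lambda>l. \<mu> j * W q l)" for j
      unfolding W
      by (rule ext, subst A_dir_shift_combination
            [where v = v and c = "\<lambda>p. \<xi> q ^ p" and a = "\<lambda>p. axis i (int p)"])
         (simp add: e sum_distrib_left mult_ac)
    have "W q (l + axis j 1) = c * W q l" if "\<And>l. v (l + axis j 1) = c * v l" for j c l
      unfolding W sh that by (simp add: sum_distrib_left mult_ac)
    then show "\<forall>j c. (\<forall>l. v (l + axis j 1) = c * v l) \<longrightarrow> (\<forall>l. W q (l + axis j 1) = c * W q l)"
      by blast
    show "W q (l + axis i 1) = cis (of_int (- int q) * (2 * pi / real (m $ i))) * W q l" for l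
    proof -
      define f where "f p = v (l + axis i (int p))" for p
      have fS: "v (l + axis i 1 + axis i (int p)) = f (Suc p)" for p
      proof -
        have "axis i (int (Suc p)) = axis i 1 + axis i (int p)"
          by (simp add: vec_eq_iff axis_def)
        then show ?thesis by (simp add: f_def add.assoc)
      qed
      have "f N = f 0"
        using per by (simp add: f_def N_def periodic_grid_function_def axis_def
            zero_vec_def[symmetric])
      moreover have "\<xi> q ^ N = 1"
      proof -
        have "real N * (2 * pi * real q / real N) = 2 * pi * real q" using N by simp
        then show ?thesis
          unfolding \<xi>_def Complex.DeMoivre by (simp only: cis_multiple_2pi[OF Ints_of_nat])
      qed
      moreover have "(\<Sum>p<N. \<xi> q ^ Suc p * f (Suc p)) + \<xi> q ^ 0 * f 0
          = (\<Sum>p<N. \<xi> q ^ p * f p) + \<xi> q ^ N * f N"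
        using sum.lessThan_Suc[of "\<lambda>p. \<xi> q ^ p * f p" N]
          sum.lessThan_Suc_shift[of "\<lambda>p. \<xi> q ^ p * f p" N] by (simp add: add.commute)
      ultimately have "\<xi> q * W q (l + axis i 1) = W q l"
        by (simp add: W fS f_def[symmetric] sum_distrib_left mult.assoc)
      moreover have "cis (of_int (- int q) * (2 * pi / real (m $ i))) * \<xi> q = 1"
        by (simp add: \<xi>_def N_def cis_mult)
      ultimately show ?thesis by (metis mult.assoc mult_1)
    qed
  qed
qed

theorem joint_eigenvalues_iff:
  fixes D \<beta> :: "real^'n^'n"
  assumes \<Delta>t: "\<Delta>t > 0" and m: "\<And>j. m $ j \<ge> 1"
  shows "joint_eigenvalues D \<beta> h m \<mu>0 \<mu> \<longleftrightarrow>
    (\<exists>\<phi>. grid_angles m \<phi> \<and>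
         of_real \<Delta>t * \<mu>0 = of_real (scaled_eigenvalue_mixed D \<beta> \<Delta>t h \<phi>) \<and>
         (\<forall>j. of_real \<Delta>t * \<mu> j = of_real (scaled_eigenvalue_dir D \<Delta>t h \<phi> j)))"
    (is "?L \<longleftrightarrow> ?R")
proof
  assume ?L
  then obtain v0 where v0: "periodic_grid_function m v0" "v0 \<noteq> (\<lambda>l. 0)"
    "A_mixed D \<beta> h v0 = (\<lambda>l. \<mu>0 * v0 l)" "\<And>j. A_dir D h j v0 = (\<lambda>l. \<mu> j * v0 l)"
    unfolding joint_eigenvalues_def by blast
  have "\<exists>v Q. periodic_grid_function m v \<and> v \<noteq> (\<lambda>l. 0) \<and>
      A_mixed D \<beta> h v = (\<lambda>l. \<mu>0 * v l) \<and> (\<forall>j. A_dir D h j v = (\<lambda>l. \<mu> j * v l)) \<and>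
      (\<forall>j\<in>S. \<forall>l. v (l + axis j 1) = cis (of_int (Q j) * (2 * pi / real (m $ j))) * v l)"
    for S :: "'n set"
  proof (induction S rule: finite_induct[OF finite])
    case 1
    then show ?case using v0 by blast
  next
    case (2 i S)
    then obtain v and Q :: "'n \<Rightarrow> int" where v: "periodic_grid_function m v" "v \<noteq> (\<lambda>l. 0)"
      "A_mixed D \<beta> h v = (\<lambda>l. \<mu>0 * v l)" "\<And>j. A_dir D h j v = (\<lambda>l. \<mu> j * v l)"
      and Q: "\<And>j l. j \<in> S \<Longrightarrow>
        v (l + axis j 1) = cis (of_int (Q j) * (2 * pi / real (m $ j))) * v l"
      by blast
    obtain q w where w: "periodic_grid_function m w" "w \<noteq> (\<lambda>l. 0)"
      "A_mixed D \<beta> h w = (\<lambda>l. \<mu>0 * w l)" "\<And>j. A_dir D h j w = (\<lambda>l. \<mu> j * w l)"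
      "\<And>l. w (l + axis i 1) = cis (of_int q * (2 * pi / real (m $ i))) * w l"
      "\<forall>j c. (\<forall>l. v (l + axis j 1) = c * v l) \<longrightarrow> (\<forall>l. w (l + axis j 1) = c * w l)"
      by (rule periodic_projection[OF m[of i] v], rule that)
    have "w (l + axis j 1) = cis (of_int ((Q(i := q)) j) * (2 * pi / real (m $ j))) * w l"
      if "j \<in> insert i S" for j l
    proof (cases "j = i")
      case False
      then have "j \<in> S" using that by simp
      then have "w (l + axis j 1) = cis (of_int (Q j) * (2 * pi / real (m $ j))) * w l"
        using w(6) Q by simp
      then show ?thesis using False by simp
    qed (simp add: w(5))
    then show ?case
      by (intro exI[of _ w] exI[of _ "Q(i := q)"] conjI ballI allI w(1-4)) simp_all
  qed
  from this[of UNIV] obtain v and Q :: "'n \<Rightarrow> int" where v: "v \<noteq> (\<lambda>l. 0)"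
    "A_mixed D \<beta> h v = (\<lambda>l. \<mu>0 * v l)" "\<And>j. A_dir D h j v = (\<lambda>l. \<mu> j * v l)"
    and Q: "\<And>j l. v (l + axis j 1) = cis (of_int (Q j) * (2 * pi / real (m $ j))) * v l"
    by blast
  define \<phi> where "\<phi> j = of_int (Q j) * (2 * pi / real (m $ j))" for j
  obtain l where l: "v l \<noteq> 0" using v(1) by auto
  have s: "\<And>j l. v (l + axis j 1) = cis (\<phi> j) * v l" using Q by (simp add: \<phi>_def)
  have "grid_angles m \<phi>" by (auto simp: grid_angles_def \<phi>_def)
  moreover have "of_real \<Delta>t * \<mu>0 = of_real (scaled_eigenvalue_mixed D \<beta> \<Delta>t h \<phi>)"
    using fourier_mode_mixed[of v \<phi> \<Delta>t D \<beta> h l, OF s] v(2) l by (simp add: mult.assoc[symmetric])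
  moreover have "of_real \<Delta>t * \<mu> j = of_real (scaled_eigenvalue_dir D \<Delta>t h \<phi> j)" for j
    using fourier_mode_dir[of v \<phi> \<Delta>t D h j l, OF s] v(3) l by (simp add: mult.assoc[symmetric])
  ultimately show ?R by blast
next
  assume ?R
  then obtain \<phi> where \<phi>: "grid_angles m \<phi>"
    and e0: "of_real \<Delta>t * \<mu>0 = of_real (scaled_eigenvalue_mixed D \<beta> \<Delta>t h \<phi>)"
    and e: "\<And>j. of_real \<Delta>t * \<mu> j = of_real (scaled_eigenvalue_dir D \<Delta>t h \<phi> j)" by blast
  define v where "v l = cis (\<Sum>j\<in>UNIV. of_int (l $ j) * \<phi> j)" for l :: "int^'n"
  have sh: "v (l + axis j x) = cis (of_int x * \<phi> j) * v l" for j l x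
  proof -
    have "(\<Sum>k\<in>UNIV. of_int ((l + axis j x) $ k) * \<phi> k)
        = of_int x * \<phi> j + (\<Sum>k\<in>UNIV. of_int (l $ k) * \<phi> k)"
      by (simp add: axis_def distrib_right sum.distrib if_distrib[of of_int]
          if_distrib[of "\<lambda>t. t * _"] cong: if_cong)
    then show ?thesis by (simp add: v_def cis_mult)
  qed
  have s: "\<And>j l. v (l + axis j 1) = cis (\<phi> j) * v l" using sh[where x = 1] by simp
  have per: "periodic_grid_function m v"
    unfolding periodic_grid_function_def
  proof (intro allI)
    fix j l
    obtain q :: int where "\<phi> j = of_int q * (2 * pi / real (m $ j))"
      using \<phi> unfolding grid_angles_def by blast
    then have "of_int (int (m $ j)) * \<phi> j = 2 * pi * of_int q"
      using m[of j] by simp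
    then show "v (l + axis j (int (m $ j))) = v l"
      unfolding sh by (metis cis_multiple_2pi Ints_of_int mult_1)
  qed
  have t0: "complex_of_real \<Delta>t \<noteq> 0" using \<Delta>t by simp
  have "A_mixed D \<beta> h v = (\<lambda>l. \<mu>0 * v l)"
    using fourier_mode_mixed[of v \<phi> \<Delta>t D \<beta> h, OF s] t0
    by (simp add: fun_eq_iff e0[symmetric] mult.assoc)
  moreover have "A_dir D h j v = (\<lambda>l. \<mu> j * v l)" for j
    using fourier_mode_dir[of v \<phi> \<Delta>t D h j, OF s] t0
    by (simp add: fun_eq_iff e[symmetric] mult.assoc)
  moreover have "v \<noteq> (\<lambda>l. 0)" by (simp add: v_def fun_eq_iff)
  ultimately show ?L using per unfolding joint_eigenvalues_def by blast
qed

theorem unconditionally_stable_iff: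
  fixes D \<beta> :: "real^'n^'n"
  shows "unconditionally_stable sch \<theta> D \<beta> \<longleftrightarrow>
    (\<forall>\<Delta>t h m \<phi>.
       \<Delta>t > 0 \<longrightarrow> (\<forall>i. h $ i > 0) \<longrightarrow> (\<forall>j. m $ j \<ge> 1) \<longrightarrow> grid_angles m \<phi> \<longrightarrow>
       cmod (stability_function sch \<theta> (of_real (scaled_eigenvalue_mixed D \<beta> \<Delta>t h \<phi>))
               (\<lambda>j. of_real (scaled_eigenvalue_dir D \<Delta>t h \<phi> j))) \<le> 1)"
    (is "?L \<longleftrightarrow> ?R")
proof
  assume L: ?L
  show ?R
  proof (intro allI impI)
    fix \<Delta>t :: real and h :: "real^'n" and m :: "nat^'n" and \<phi> :: "'n \<Rightarrow> real"
    assume a: "\<Delta>t > 0" "\<forall>i. h $ i > 0" "\<forall>j. m $ j \<ge> 1" "grid_angles m \<phi>"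
    define \<mu>0 where "\<mu>0 = complex_of_real (scaled_eigenvalue_mixed D \<beta> \<Delta>t h \<phi>) / of_real \<Delta>t"
    define \<mu> where "\<mu> j = complex_of_real (scaled_eigenvalue_dir D \<Delta>t h \<phi> j) / of_real \<Delta>t" for j
    have eq: "of_real \<Delta>t * \<mu>0 = of_real (scaled_eigenvalue_mixed D \<beta> \<Delta>t h \<phi>)"
      "of_real \<Delta>t * \<mu> j = of_real (scaled_eigenvalue_dir D \<Delta>t h \<phi> j)" for j
      using a(1) by (simp_all add: \<mu>0_def \<mu>_def)
    have "joint_eigenvalues D \<beta> h m \<mu>0 \<mu>"
      using joint_eigenvalues_iff[OF a(1), of m] a(3,4) eq by blast
    then show "cmod (stability_function sch \<theta> (of_real (scaled_eigenvalue_mixed D \<beta> \<Delta>t h \<phi>))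
        (\<lambda>j. of_real (scaled_eigenvalue_dir D \<Delta>t h \<phi> j))) \<le> 1"
      using L a unfolding unconditionally_stable_def eq[symmetric] by blast
  qed
next
  assume R: ?R
  show ?L
    unfolding unconditionally_stable_def
  proof (intro allI impI)
    fix \<Delta>t :: real and h :: "real^'n" and m :: "nat^'n" and \<mu>0 and \<mu> :: "'n \<Rightarrow> complex"
    assume a: "\<Delta>t > 0" "\<forall>i. h $ i > 0" "\<forall>j. m $ j \<ge> 1" "joint_eigenvalues D \<beta> h m \<mu>0 \<mu>"
    obtain \<phi> where "grid_angles m \<phi>"
      and "of_real \<Delta>t * \<mu>0 = complex_of_real (scaled_eigenvalue_mixed D \<beta> \<Delta>t h \<phi>)"
        "\<And>j. of_real \<Delta>t * \<mu> j = complex_of_real (scaled_eigenvalue_dir D \<Delta>t h \<phi> j)"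
      using joint_eigenvalues_iff[OF a(1), of m] a(3,4) by blast
    then show "cmod (stability_function sch \<theta> (of_real \<Delta>t * \<mu>0) (\<lambda>j. of_real \<Delta>t * \<mu> j)) \<le> 1"
      using R a by simp
  qed
qed

end

theory Submission
  imports Defs
begin

text \<open>
  All eigenvalues are real, so stability amounts to inequalities between real numbers. Write
  \<open>z j = - (x j)\<^sup>2\<close> with \<open>x j \<ge> 0\<close>, and let \<open>S\<close> be the sum of the \<open>(x j)\<^sup>2\<close>, \<open>T\<close> the sum of
  \<open>x i * x j\<close> over the ordered pairs \<open>i \<noteq> j\<close>, and \<open>p\<close> the product of the \<open>1 + \<theta> * (x j)\<^sup>2\<close>. The
  hypotheses on \<open>D\<close> and \<open>\<beta>\<close> yield two facts (\<open>scaled_eigenvalue_bounds\<close>). First, the number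
  \<open>w = S - z0\<close>, which is minus the sum of all the scaled eigenvalues, is nonnegative: it is the form
  of \<open>D\<close> at the vector of the sines plus the form of the entrywise product of \<open>D\<close> and \<open>-\<beta>\<close>, which is
  positive semidefinite by the Schur product theorem, at the vector of the \<open>1 - cos (\<phi> j)\<close> (both
  vectors with entries multiplied by \<open>sqrt \<Delta>t / h $ j\<close>). Second, \<open>\<bar>z0\<bar> \<le> \<gamma> * T\<close> by the
  Cauchy-Schwarz inequality, so that \<open>w \<le> S + \<gamma> * T\<close>.

  The bound \<open>\<bar>M\<bar> \<le> 1\<close> then follows from \<open>w \<le> 2 * p\<close> for the Douglas scheme, from
  \<open>w \<le> 2 * p + 2 * \<theta> * S\<close> for the modified Craig-Sneyd scheme, from \<open>w \<le> 4 * p - 2\<close> for the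
  Hundsdorfer-Verwer scheme, and from \<open>S \<le> 2 * p\<close> and \<open>z0 \<ge> - 2 * p\<close> for the Craig-Sneyd scheme. In all
  cases what is missing is a lower bound for \<open>p\<close> in terms of \<open>S\<close> and \<open>T\<close>. The terms of \<open>p\<close> of
  higher degree are expressed by the products \<open>q = \<theta> * x i * x j\<close>, and the bounds
  \<open>implicit_factor_lower_bound_two\<close> and \<open>implicit_factor_lower_bound_three\<close> linearize them
  about the point where all \<open>q\<close> equal a parameter \<open>r\<close>. The parameter is chosen so that the constant
  term of the bound is what the scheme calls for: \<open>0\<close> for comparing with \<open>2 * p\<close> (\<open>r = 1\<close> for two and
  \<open>r = 1/2\<close> for three directions), and \<open>1/2\<close> for comparing with \<open>4 * p - 2\<close>, which is where \<open>sqrt 2\<close>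
  and \<open>sqrt 3\<close> come from. Bounding the remaining multiple of \<open>S\<close> from below by means of \<open>S \<ge> T\<close>
  or \<open>S \<ge> T / 2\<close> leaves a multiple of \<open>T\<close> whose coefficient is linear in \<open>\<theta>\<close> and \<open>\<gamma>\<close>; its
  nonnegativity is where the \<open>\<gamma>\<close>-dependent lower bounds on \<open>\<theta>\<close> come from.
\<close>


section \<open>The Schur product theorem\<close>

lemma psd_iff_quadratic_form:
  fixes M :: "real^'n^'n"
  shows "psd M \<longleftrightarrow> (\<forall>x. 0 \<le> (\<Sum>i\<in>UNIV. \<Sum>j\<in>UNIV. M $ i $ j * (x i * x j)))"
proof -
  have q: "x \<bullet> (M *v x) = (\<Sum>i\<in>UNIV. \<Sum>j\<in>UNIV. M $ i $ j * (x $ i * x $ j))" for x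
    by (simp add: inner_vec_def matrix_vector_mult_def sum_distrib_left mult_ac)
  show ?thesis
    unfolding psd_def q
  proof (intro iffI allI)
    fix x assume *: "\<forall>x::real^'n. 0 \<le> (\<Sum>i\<in>UNIV. \<Sum>j\<in>UNIV. M $ i $ j * (x $ i * x $ j))"
    show "0 \<le> (\<Sum>i\<in>UNIV. \<Sum>j\<in>UNIV. M $ i $ j * (x i * x j))"
      using *[rule_format, of "\<chi> i. x i"] by simp
  qed auto
qed

lemma quadratic_form_shift_coordinate:
  fixes a :: "'n::finite \<Rightarrow> 'n \<Rightarrow> real"
  assumes sym: "\<And>i j. a i j = a j i"
  shows "(\<Sum>i\<in>UNIV. \<Sum>j\<in>UNIV. a i j * ((x i + t * of_bool (i = k)) * (x j + t * of_bool (j = k))))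
    = (\<Sum>i\<in>UNIV. \<Sum>j\<in>UNIV. a i j * (x i * x j)) + 2 * t * (\<Sum>j\<in>UNIV. a k j * x j) + t\<^sup>2 * a k k"
proof -
  have "(\<Sum>i\<in>UNIV. \<Sum>j\<in>UNIV. a i j * ((x i + t * of_bool (i = k)) * (x j + t * of_bool (j = k))))
    = (\<Sum>i\<in>UNIV. \<Sum>j\<in>UNIV. a i j * (x i * x j))
      + t * (\<Sum>i\<in>UNIV. \<Sum>j\<in>UNIV. if j = k then a i j * x i else 0)
      + t * (\<Sum>i\<in>UNIV. \<Sum>j\<in>UNIV. if i = k then a i j * x j else 0)
      + t\<^sup>2 * (\<Sum>i\<in>UNIV. \<Sum>j\<in>UNIV. if j = k then if i = k then a i j else 0 else 0)"
    unfolding sum_distrib_left sum.distrib[symmetric]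
    by (intro sum.cong refl) (auto simp: algebra_simps power2_eq_square)
  moreover have "(\<Sum>i\<in>UNIV. \<Sum>j\<in>UNIV. if j = k then a i j * x i else 0) = (\<Sum>j\<in>UNIV. a k j * x j)"
    using sym by (simp add: mult.commute)
  moreover have "(\<Sum>i\<in>UNIV. \<Sum>j\<in>UNIV. if i = k then a i j * x j else 0) = (\<Sum>j\<in>UNIV. a k j * x j)"
    by (subst sum.swap) simp
  ultimately show ?thesis by simp
qed

text \<open>
  Symmetric Gaussian elimination of one index writes \<open>a\<close> as a rank-one matrix
  \<open>a k i * a k j / a k k\<close> plus a positive semidefinite matrix that vanishes in row and column
  \<open>k\<close>. The rank-one part contributes the value of the form \<open>b\<close> at the vector \<open>a k i * y i\<close>,
  divided by \<open>a k k\<close>. The set \<open>S\<close> collects the indices that are not yet eliminated.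
\<close>

lemma schur_product_nonneg:
  fixes a b :: "'n::finite \<Rightarrow> 'n \<Rightarrow> real"
  assumes sym: "\<And>i j. a i j = a j i"
    and a: "\<And>x. 0 \<le> (\<Sum>i\<in>UNIV. \<Sum>j\<in>UNIV. a i j * (x i * x j))"
    and b: "\<And>x. 0 \<le> (\<Sum>i\<in>UNIV. \<Sum>j\<in>UNIV. b i j * (x i * x j))"
  shows "0 \<le> (\<Sum>i\<in>UNIV. \<Sum>j\<in>UNIV. a i j * b i j * (y i * y j))"
proof -
  have "0 \<le> (\<Sum>i\<in>UNIV. \<Sum>j\<in>UNIV. a i j * b i j * (y i * y j))"
    if "\<And>i j. i \<notin> S \<Longrightarrow> a i j = 0" "\<And>i j. a i j = a j i"
      "\<And>x. 0 \<le> (\<Sum>i\<in>UNIV. \<Sum>j\<in>UNIV. a i j * (x i * x j))" for S a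
    using finite[of S] that
  proof (induction S arbitrary: a rule: finite_induct)
    case (insert k S)
    note sym = insert.prems(2) and pos = insert.prems(3)
    have line: "0 \<le> (\<Sum>i\<in>UNIV. \<Sum>j\<in>UNIV. a i j * (x i * x j))
        + 2 * t * (\<Sum>j\<in>UNIV. a k j * x j) + t\<^sup>2 * a k k" for x t
      using pos[of "\<lambda>i. x i + t * of_bool (i = k)"]
      unfolding quadratic_form_shift_coordinate[OF sym] .
    show ?case
    proof (cases "a k k = 0")
      case True
      \<comment> \<open>a nonzero entry in this row would make the form affine and unbounded below on a line\<close>
      have "a k l = 0" for l
      proof (rule ccontr)
        assume nz: "a k l \<noteq> 0"
        have e: "(\<Sum>i\<in>UNIV. \<Sum>j\<in>UNIV. a i j * (of_bool (i = l) * of_bool (j = l))) = a l l"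
          "(\<Sum>j\<in>UNIV. a k j * of_bool (j = l)) = a k l"
          by (simp_all add: of_bool_def if_distrib[of "\<lambda>t. _ * t"] cong: if_cong)
        define t where "t = - (a l l + 1) / (2 * a k l)"
        have "2 * t * a k l = - (a l l + 1)" using nz by (simp add: t_def)
        then have "0 \<le> a l l - (a l l + 1)"
          using line[of "\<lambda>i. of_bool (i = l)" t] unfolding e True by simp
        then show False by simp
      qed
      then have "a i j = 0" if "i \<notin> S" for i j
        using insert.prems(1)[of i j] that by (cases "i = k") auto
      then show ?thesis using sym pos by (rule insert.IH)
    next
      case False
      moreover have "a k k \<ge> 0"
        using line[of "\<lambda>_. 0" 1] by simp
      ultimately have akk: "a k k > 0" by simp
      define a' where "a' i j = a i j - a k i * a k j / a k k" for i j
      have split: "(\<Sum>i\<in>UNIV. \<Sum>j\<in>UNIV. a i j * c i j * (x i * x j))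
          = (\<Sum>i\<in>UNIV. \<Sum>j\<in>UNIV. a' i j * c i j * (x i * x j))
            + (\<Sum>i\<in>UNIV. \<Sum>j\<in>UNIV. c i j * ((a k i * x i) * (a k j * x j))) / a k k" for c x
        unfolding sum_divide_distrib sum.distrib[symmetric]
        by (intro sum.cong refl) (simp add: a'_def algebra_simps)
      have "0 \<le> (\<Sum>i\<in>UNIV. \<Sum>j\<in>UNIV. a' i j * b i j * (y i * y j))"
      proof (rule insert.IH)
        show "a' i j = 0" if "i \<notin> S" for i j
          using insert.prems(1)[of i] sym[of k i] that akk by (cases "i = k") (simp_all add: a'_def)
        show "a' i j = a' j i" for i j
          using sym[of i j] by (simp add: a'_def)
        show "0 \<le> (\<Sum>i\<in>UNIV. \<Sum>j\<in>UNIV. a' i j * (x i * x j))" for x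
        proof -
          define L where "L = (\<Sum>j\<in>UNIV. a k j * x j)"
          have "(\<Sum>i\<in>UNIV. \<Sum>j\<in>UNIV. (a k i * x i) * (a k j * x j)) = L\<^sup>2"
            by (simp add: L_def power2_eq_square sum_product)
          then have "(\<Sum>i\<in>UNIV. \<Sum>j\<in>UNIV. a' i j * (x i * x j))
              = (\<Sum>i\<in>UNIV. \<Sum>j\<in>UNIV. a i j * (x i * x j)) - L\<^sup>2 / a k k"
            using split[of "\<lambda>_ _. 1" x] by simp
          also have "\<dots> \<ge> 0"
            \<comment> \<open>this number is the minimum of the form of \<open>a\<close> on the line through \<open>x\<close> in direction \<open>k\<close>\<close>
            using line[of x "- L / a k k"] akk
            unfolding L_def[symmetric] by (simp add: field_simps power2_eq_square)
          finally show ?thesis .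
        qed
      qed
      then show ?thesis
        unfolding split[of b y] using b[of "\<lambda>i. a k i * y i"] akk by simp
    qed
  qed simp
  from this[of UNIV a] sym a show ?thesis by simp
qed


section \<open>Bounds for the eigenvalues\<close>

lemma sum_offdiagonal:
  fixes f :: "'n::finite \<Rightarrow> 'n \<Rightarrow> real"
  shows "(\<Sum>i\<in>UNIV. \<Sum>j\<in>UNIV. f i j) = (\<Sum>i\<in>UNIV. \<Sum>j\<in>UNIV - {i}. f i j) + (\<Sum>i\<in>UNIV. f i i)"
proof -
  have "(\<Sum>j\<in>UNIV. f i j) = (\<Sum>j\<in>UNIV - {i}. f i j) + f i i" for i
    by (simp add: sum.remove[of UNIV i] add.commute)
  then show ?thesis by (simp add: sum.distrib)
qed

lemma psd_diagonal_nonneg: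
  assumes "psd (M :: real^'n^'n)"
  shows "0 \<le> M $ i $ i"
  using assms[unfolded psd_iff_quadratic_form, rule_format, of "\<lambda>l. of_bool (l = i)"]
  by (simp add: of_bool_def if_distrib[of "\<lambda>t. _ * t"] cong: if_cong)

lemma psd_unit_diagonal_entry_bound:
  fixes M :: "real^'n^'n"
  assumes M: "psd M" and sym: "M $ j $ i = M $ i $ j"
    and diag: "M $ i $ i = 1" "M $ j $ j = 1" and ij: "i \<noteq> j"
  shows "\<bar>M $ i $ j\<bar> \<le> 1"
proof -
  have "0 \<le> 2 + 2 * t * M $ i $ j" if t: "t\<^sup>2 = 1" for t
  proof -
    have "(\<Sum>l\<in>UNIV. \<Sum>m\<in>UNIV. M $ l $ m *
        ((if l = i then 1 else if l = j then t else 0) * (if m = i then 1 else if m = j then t else 0)))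
      = (\<Sum>l\<in>{i,j}. \<Sum>m\<in>{i,j}. M $ l $ m *
        ((if l = i then 1 else if l = j then t else 0) * (if m = i then 1 else if m = j then t else 0)))"
      by (intro sum.mono_neutral_cong_right ballI sum.neutral) auto
    also have "\<dots> = 2 + 2 * t * M $ i $ j"
      using ij sym diag t by (simp add: power2_eq_square algebra_simps)
    finally show ?thesis
      using M[unfolded psd_iff_quadratic_form, rule_format,
          of "\<lambda>l. if l = i then 1 else if l = j then t else 0"] by simp
  qed
  \<comment> \<open>the form at the sum and the difference of two unit vectors\<close>
  from this[of 1] this[of "-1"] show ?thesis by simp
qed

text \<open>
  Since \<open>(sin \<phi>)\<^sup>2 + (1 - cos \<phi>)\<^sup>2 = 2 (1 - cos \<phi>)\<close>, this is the Cauchy-Schwarz inequality for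
  the vectors \<open>(\<bar>sin \<phi>\<bar>, 1 - cos \<phi>)\<close> and \<open>(\<bar>sin \<psi>\<bar>, 1 - cos \<psi>)\<close>.
\<close>

lemma mixed_symbol_bound:
  fixes \<phi> \<psi> b :: real
  assumes b: "\<bar>b\<bar> \<le> 1"
  shows "\<bar>- sin \<phi> * sin \<psi> + b * (1 - cos \<phi>) * (1 - cos \<psi>)\<bar>
    \<le> 2 * sqrt ((1 - cos \<phi>) * (1 - cos \<psi>))"
proof -
  define s t u v where "s = sin \<phi>" and "t = sin \<psi>" and "u = 1 - cos \<phi>" and "v = 1 - cos \<psi>"
  have u: "s\<^sup>2 + u\<^sup>2 = 2 * u" and v: "t\<^sup>2 + v\<^sup>2 = 2 * v"
    unfolding s_def t_def u_def v_def sin_squared_eq by (simp_all add: power2_eq_square algebra_simps)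
  have nn: "u \<ge> 0" "v \<ge> 0" by (simp_all add: u_def v_def)
  have "\<bar>- s * t + b * u * v\<bar> \<le> \<bar>s * t\<bar> + \<bar>b * (u * v)\<bar>" by (simp add: mult.assoc)
  also have "\<bar>b * (u * v)\<bar> \<le> u * v"
    using mult_right_mono[OF b, of "u * v"] nn by (simp add: abs_mult)
  finally have 1: "\<bar>- s * t + b * u * v\<bar> \<le> \<bar>s * t\<bar> + u * v" by simp
  have "(\<bar>s * t\<bar> + u * v)\<^sup>2 \<le> (s\<^sup>2 + u\<^sup>2) * (t\<^sup>2 + v\<^sup>2)"
  proof -
    have "(s\<^sup>2 + u\<^sup>2) * (t\<^sup>2 + v\<^sup>2) - (\<bar>s\<bar> * \<bar>t\<bar> + u * v)\<^sup>2 = (\<bar>s\<bar> * v - \<bar>t\<bar> * u)\<^sup>2"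
      by (simp add: power2_eq_square algebra_simps)
    then show ?thesis
      by (metis abs_mult diff_ge_0_iff_ge zero_le_power2)
  qed
  also have "\<dots> = (2 * sqrt (u * v))\<^sup>2"
    unfolding u v using nn by (simp add: power_mult_distrib)
  finally have "\<bar>s * t\<bar> + u * v \<le> 2 * sqrt (u * v)"
    by (rule power2_le_imp_le) (use nn in simp)
  with 1 show ?thesis by (simp add: s_def t_def u_def v_def)
qed

lemma scaled_eigenvalue_bounds:
  fixes D \<beta> :: "real^'n^'n" and h :: "real^'n" and \<phi> :: "'n \<Rightarrow> real"
  assumes D_sym: "transpose D = D" and D_psd: "psd D"
    and D_\<gamma>: "\<And>i j. i \<noteq> j \<Longrightarrow> \<bar>D $ i $ j\<bar> \<le> \<gamma> * sqrt (D $ i $ i * D $ j $ j)"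
    and \<beta>_sym: "\<And>i j. i \<noteq> j \<Longrightarrow> \<beta> $ i $ j = \<beta> $ j $ i" and \<beta>_diag: "\<And>i. \<beta> $ i $ i = -1"
    and B_psd: "psd (- \<beta>)" and \<Delta>t: "\<Delta>t > 0" and h: "\<And>i. h $ i > 0"
  defines "x \<equiv> \<lambda>j. sqrt (- scaled_eigenvalue_dir D \<Delta>t h \<phi> j)"
  shows "scaled_eigenvalue_dir D \<Delta>t h \<phi> j = - (x j)\<^sup>2"
    and "scaled_eigenvalue_mixed D \<beta> \<Delta>t h \<phi> \<le> (\<Sum>j\<in>UNIV. (x j)\<^sup>2)"
    and "\<bar>scaled_eigenvalue_mixed D \<beta> \<Delta>t h \<phi>\<bar> \<le> \<gamma> * (\<Sum>i\<in>UNIV. \<Sum>j\<in>UNIV - {i}. x i * x j)"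
proof -
  define g where "g j = sqrt \<Delta>t / h $ j" for j
  have g: "g j > 0" for j using \<Delta>t h by (simp add: g_def)
  have gg: "\<Delta>t / (h $ i * h $ j) = g i * g j" for i j
    using \<Delta>t by (simp add: g_def)
  have D0: "D $ j $ j \<ge> 0" for j by (rule psd_diagonal_nonneg[OF D_psd])
  have dir: "scaled_eigenvalue_dir D \<Delta>t h \<phi> j = - (2 * (g j)\<^sup>2 * D $ j $ j * (1 - cos (\<phi> j)))" for j
    by (simp add: scaled_eigenvalue_dir_def gg power2_eq_square)
  have x2: "(x j)\<^sup>2 = 2 * (g j)\<^sup>2 * D $ j $ j * (1 - cos (\<phi> j))" for j
    using D0 by (simp add: x_def dir)
  show dir': "scaled_eigenvalue_dir D \<Delta>t h \<phi> j = - (x j)\<^sup>2" for j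
    by (simp add: dir x2)
  let ?B = "- \<beta>"
  show "scaled_eigenvalue_mixed D \<beta> \<Delta>t h \<phi> \<le> (\<Sum>j\<in>UNIV. (x j)\<^sup>2)"
  proof -
    let ?s = "\<lambda>i. g i * sin (\<phi> i)" and ?y = "\<lambda>i. g i * (1 - cos (\<phi> i))"
    have "(\<Sum>i\<in>UNIV. \<Sum>j\<in>UNIV. D $ i $ j * (?s i * ?s j))
        + (\<Sum>i\<in>UNIV. \<Sum>j\<in>UNIV. D $ i $ j * ?B $ i $ j * (?y i * ?y j)) \<ge> 0"
    proof (rule add_nonneg_nonneg)
      show "0 \<le> (\<Sum>i\<in>UNIV. \<Sum>j\<in>UNIV. D $ i $ j * (?s i * ?s j))"
        by (rule D_psd[unfolded psd_iff_quadratic_form, rule_format])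
      show "0 \<le> (\<Sum>i\<in>UNIV. \<Sum>j\<in>UNIV. D $ i $ j * ?B $ i $ j * (?y i * ?y j))"
      proof (rule schur_product_nonneg)
        show "D $ i $ j = D $ j $ i" for i j
          by (subst D_sym[symmetric]) (simp add: transpose_def)
      qed (use D_psd B_psd in \<open>simp_all only: psd_iff_quadratic_form\<close>)
    qed
    also have "(\<Sum>i\<in>UNIV. \<Sum>j\<in>UNIV. D $ i $ j * (?s i * ?s j))
        + (\<Sum>i\<in>UNIV. \<Sum>j\<in>UNIV. D $ i $ j * ?B $ i $ j * (?y i * ?y j))
      = (\<Sum>i\<in>UNIV. (x i)\<^sup>2) - scaled_eigenvalue_mixed D \<beta> \<Delta>t h \<phi>"
    proof -
      let ?f = "\<lambda>i j. D $ i $ j * (?s i * ?s j) + D $ i $ j * ?B $ i $ j * (?y i * ?y j)"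
      have d: "?f i i = (x i)\<^sup>2" for i
      proof -
        have "?f i i = D $ i $ i * (g i)\<^sup>2 * ((sin (\<phi> i))\<^sup>2 + (1 - cos (\<phi> i))\<^sup>2)"
        proof -
          have "d * ((c * s) * (c * s)) + d * 1 * ((c * u) * (c * u)) = d * c\<^sup>2 * (s\<^sup>2 + u\<^sup>2)"
            for d c s u :: real by (simp add: power2_eq_square algebra_simps)
          then show ?thesis by (simp add: \<beta>_diag)
        qed
        also have "(sin (\<phi> i))\<^sup>2 + (1 - cos (\<phi> i))\<^sup>2 = 2 * (1 - cos (\<phi> i))"
          unfolding sin_squared_eq by (simp add: power2_eq_square algebra_simps)
        finally show ?thesis by (simp add: x2)
      qed
      have "(\<Sum>i\<in>UNIV. \<Sum>j\<in>UNIV - {i}. ?f i j) = - scaled_eigenvalue_mixed D \<beta> \<Delta>t h \<phi>"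
        unfolding scaled_eigenvalue_mixed_def gg sum_negf[symmetric]
        by (intro sum.cong refl) (simp add: algebra_simps)
      then have "(\<Sum>i\<in>UNIV. \<Sum>j\<in>UNIV. ?f i j)
          = (\<Sum>i\<in>UNIV. (x i)\<^sup>2) - scaled_eigenvalue_mixed D \<beta> \<Delta>t h \<phi>"
        unfolding sum_offdiagonal[of ?f] d by linarith
      then show ?thesis unfolding sum.distrib .
    qed
    finally show ?thesis by simp
  qed
  show "\<bar>scaled_eigenvalue_mixed D \<beta> \<Delta>t h \<phi>\<bar> \<le> \<gamma> * (\<Sum>i\<in>UNIV. \<Sum>j\<in>UNIV - {i}. x i * x j)"
    unfolding scaled_eigenvalue_mixed_def sum_distrib_left
  proof (intro order.trans[OF sum_abs] sum_mono)
    fix i j :: 'n assume "j \<in> UNIV - {i}"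
    then have ij: "i \<noteq> j" by simp
    let ?f = "- sin (\<phi> i) * sin (\<phi> j) + \<beta> $ i $ j * (1 - cos (\<phi> i)) * (1 - cos (\<phi> j))"
    have "\<bar>\<beta> $ i $ j\<bar> \<le> 1"
      using psd_unit_diagonal_entry_bound[OF B_psd, of j i] \<beta>_sym[OF ij] \<beta>_diag ij by simp
    note f = mixed_symbol_bound[OF this, of "\<phi> i" "\<phi> j"]
    have "x i * x j = sqrt ((x i)\<^sup>2 * (x j)\<^sup>2)"
      using D0 by (simp add: real_sqrt_mult x_def dir)
    also have "(x i)\<^sup>2 * (x j)\<^sup>2 =
        (2 * (g i * g j))\<^sup>2 * ((D $ i $ i * D $ j $ j) * ((1 - cos (\<phi> i)) * (1 - cos (\<phi> j))))"
      unfolding x2 by (simp add: power2_eq_square)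
    also have "sqrt \<dots> = (g i * g j) * (sqrt (D $ i $ i * D $ j $ j)
        * (2 * sqrt ((1 - cos (\<phi> i)) * (1 - cos (\<phi> j)))))"
      using g[of i] g[of j] unfolding real_sqrt_mult real_sqrt_abs by simp
    finally have xx: "x i * x j = \<dots>" .
    have "\<bar>\<Delta>t / (h $ i * h $ j) * D $ i $ j * ?f\<bar> = (g i * g j) * (\<bar>D $ i $ j\<bar> * \<bar>?f\<bar>)"
      unfolding gg abs_mult using g[of i] g[of j] by simp
    also have "\<dots> \<le> (g i * g j) * ((\<gamma> * sqrt (D $ i $ i * D $ j $ j))
        * (2 * sqrt ((1 - cos (\<phi> i)) * (1 - cos (\<phi> j)))))"
      using g[of i] g[of j] D_\<gamma>[OF ij] f
      by (intro mult_left_mono mult_mono) (auto intro: order.trans[OF abs_ge_zero])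
    finally show "\<bar>\<Delta>t / (h $ i * h $ j) * D $ i $ j * ?f\<bar> \<le> \<gamma> * (x i * x j)"
      unfolding xx by (simp only: mult_ac)
  qed
qed


section \<open>Lower bounds for the implicit factor\<close>

text \<open>
  Of three numbers, two lie on the same side of \<open>r\<close>, say \<open>(q1 - r) * (q2 - r) \<ge> 0\<close>. This bounds
  \<open>q1 * q2 * q3\<close> from below by a quadratic polynomial, and what remains is a positive definite
  quadratic form in the differences \<open>q - r\<close>. Equality holds at \<open>q1 = q2 = q3 = r\<close>.
\<close>

lemma three_variable_inequality:
  fixes q1 q2 q3 r :: real
  assumes q: "q1 \<ge> 0" "q2 \<ge> 0" "q3 \<ge> 0" and r: "0 \<le> r" "r \<le> 1"
  shows "(2 * r + r\<^sup>2) * (q1 + q2 + q3)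
    \<le> 3 * r\<^sup>2 + 2 * r ^ 3 + (q1\<^sup>2 + q2\<^sup>2 + q3\<^sup>2) + q1 * q2 * q3"
proof -
  have *: "(2 * r + r\<^sup>2) * (a + b + c) \<le> 3 * r\<^sup>2 + 2 * r ^ 3 + (a\<^sup>2 + b\<^sup>2 + c\<^sup>2) + a * b * c"
    if ab: "(a - r) * (b - r) \<ge> 0" and c: "c \<ge> 0" for a b c
  proof -
    have "r * r \<le> 1 * 1" using r by (intro mult_mono) auto
    then have "0 \<le> (1/2 - r\<^sup>2 / 4) * (c - r)\<^sup>2"
      by (intro mult_nonneg_nonneg) (simp_all add: power2_eq_square)
    then have "0 \<le> (a - r + r / 2 * (c - r))\<^sup>2 + (b - r + r / 2 * (c - r))\<^sup>2
        + 2 * ((1/2 - r\<^sup>2 / 4) * (c - r)\<^sup>2) + (a - r) * (b - r) * c"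
      using mult_nonneg_nonneg[OF ab c] by (intro add_nonneg_nonneg) simp_all
    also have "\<dots> = 3 * r\<^sup>2 + 2 * r ^ 3 + (a\<^sup>2 + b\<^sup>2 + c\<^sup>2) + a * b * c - (2 * r + r\<^sup>2) * (a + b + c)"
      by (simp add: power2_eq_square power3_eq_cube algebra_simps)
    finally show ?thesis by simp
  qed
  consider "(q1 - r) * (q2 - r) \<ge> 0" | "(q2 - r) * (q3 - r) \<ge> 0" | "(q3 - r) * (q1 - r) \<ge> 0"
    unfolding zero_le_mult_iff by linarith
  then show ?thesis
  proof cases
    case 1
    then show ?thesis using *[of q1 q2 q3] q by simp
  next
    case 2
    then show ?thesis using *[of q2 q3 q1] q by (simp add: algebra_simps)
  next
    case 3
    then show ?thesis using *[of q3 q1 q2] q by (simp add: algebra_simps)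
  qed
qed

lemma offdiagonal_sum_le_two:
  fixes x :: "'n::finite \<Rightarrow> real"
  assumes "CARD('n) = 2"
  shows "(\<Sum>i\<in>UNIV. \<Sum>j\<in>UNIV - {i}. x i * x j) \<le> (\<Sum>j\<in>UNIV. (x j)\<^sup>2)"
proof -
  obtain a b where U: "UNIV = {a, b :: 'n}" "a \<noteq> b" using assms by (metis card_2_iff)
  have "0 \<le> (x a - x b)\<^sup>2" by simp
  then show ?thesis unfolding U using U(2)
    by (simp add: insert_Diff_if power2_eq_square algebra_simps)
qed

lemma offdiagonal_sum_le_three:
  fixes x :: "'n::finite \<Rightarrow> real"
  assumes "CARD('n) = 3"
  shows "(\<Sum>i\<in>UNIV. \<Sum>j\<in>UNIV - {i}. x i * x j) \<le> 2 * (\<Sum>j\<in>UNIV. (x j)\<^sup>2)"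
proof -
  obtain a b c where U: "UNIV = {a, b, c :: 'n}" "a \<noteq> b" "a \<noteq> c" "b \<noteq> c"
    using assms by (metis card_3_iff)
  have "0 \<le> (x a - x b)\<^sup>2 + (x b - x c)\<^sup>2 + (x c - x a)\<^sup>2" by simp
  then show ?thesis unfolding U using U(2-)
    by (simp add: insert_Diff_if power2_eq_square algebra_simps)
qed

lemma implicit_factor_lower_bound_two:
  fixes x :: "'n::finite \<Rightarrow> real"
  assumes "CARD('n) = 2"
  shows "1 - r\<^sup>2 + \<theta> * (\<Sum>j\<in>UNIV. (x j)\<^sup>2) + r * \<theta> * (\<Sum>i\<in>UNIV. \<Sum>j\<in>UNIV - {i}. x i * x j)
    \<le> (\<Prod>j\<in>UNIV. 1 + \<theta> * (x j)\<^sup>2)"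
proof -
  obtain a b where U: "UNIV = {a, b :: 'n}" "a \<noteq> b" using assms by (metis card_2_iff)
  have "0 \<le> (\<theta> * x a * x b - r)\<^sup>2" by simp
  then show ?thesis unfolding U using U(2)
    by (simp add: insert_Diff_if power2_eq_square algebra_simps)
qed

text \<open>
  The terms of the product of degree above two are the squares of the numbers \<open>\<theta> * x i * x j\<close>
  with \<open>i \<noteq> j\<close> and the product of these numbers.
\<close>

lemma implicit_factor_lower_bound_three:
  fixes x :: "'n::finite \<Rightarrow> real"
  assumes "CARD('n) = 3" and x: "\<And>j. x j \<ge> 0" and \<theta>: "\<theta> \<ge> 0" and r: "0 \<le> r" "r \<le> 1"
  shows "1 - (3 * r\<^sup>2 + 2 * r ^ 3) + \<theta> * (\<Sum>j\<in>UNIV. (x j)\<^sup>2)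
      + (r + r\<^sup>2 / 2) * \<theta> * (\<Sum>i\<in>UNIV. \<Sum>j\<in>UNIV - {i}. x i * x j)
    \<le> (\<Prod>j\<in>UNIV. 1 + \<theta> * (x j)\<^sup>2)"
proof -
  obtain a b c where U: "UNIV = {a, b, c :: 'n}" "a \<noteq> b" "a \<noteq> c" "b \<noteq> c"
    using assms(1) by (metis card_3_iff)
  let ?q = "\<lambda>i j. \<theta> * x i * x j"
  have "(2 * r + r\<^sup>2) * (?q a b + ?q b c + ?q c a)
    \<le> 3 * r\<^sup>2 + 2 * r ^ 3 + ((?q a b)\<^sup>2 + (?q b c)\<^sup>2 + (?q c a)\<^sup>2) + ?q a b * ?q b c * ?q c a"
    using x \<theta> r by (intro three_variable_inequality) simp_all
  moreover have T: "(\<Sum>i\<in>UNIV. \<Sum>j\<in>UNIV - {i}. x i * x j) = 2 * (x a * x b + x b * x c + x c * x a)"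
    unfolding U using U(2-) by (simp add: insert_Diff_if algebra_simps)
  moreover have "(\<Prod>j\<in>UNIV. 1 + \<theta> * (x j)\<^sup>2) = 1 + \<theta> * (\<Sum>j\<in>UNIV. (x j)\<^sup>2)
      + ((?q a b)\<^sup>2 + (?q b c)\<^sup>2 + (?q c a)\<^sup>2) + ?q a b * ?q b c * ?q c a"
    unfolding U using U(2-) by (simp add: power2_eq_square algebra_simps)
  moreover have "(r + r\<^sup>2 / 2) * \<theta> * (\<Sum>i\<in>UNIV. \<Sum>j\<in>UNIV - {i}. x i * x j)
      = (2 * r + r\<^sup>2) * (?q a b + ?q b c + ?q c a)"
    unfolding T by (simp add: algebra_simps)
  ultimately show ?thesis by linarith
qed

lemma one_plus_sum_le_implicit_factor:
  fixes x :: "'n::finite \<Rightarrow> real"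
  assumes "\<theta> \<ge> 0"
  shows "1 + \<theta> * (\<Sum>j\<in>UNIV. (x j)\<^sup>2) \<le> (\<Prod>j\<in>UNIV. 1 + \<theta> * (x j)\<^sup>2)"
proof -
  have "1 + \<theta> * (\<Sum>j\<in>A. (x j)\<^sup>2) \<le> (\<Prod>j\<in>A. 1 + \<theta> * (x j)\<^sup>2) \<and> 1 \<le> (\<Prod>j\<in>A. 1 + \<theta> * (x j)\<^sup>2)"
    if "finite A" for A
    using that
  proof (induction A)
    case (insert k A)
    let ?p = "\<Prod>j\<in>A. 1 + \<theta> * (x j)\<^sup>2"
    have k: "0 \<le> \<theta> * (x k)\<^sup>2" using assms by simp
    then have "\<theta> * (x k)\<^sup>2 * 1 \<le> \<theta> * (x k)\<^sup>2 * ?p" using insert.IH by (intro mult_left_mono) auto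
    then show ?case using insert k by (simp add: algebra_simps)
  qed simp
  then show ?thesis by simp
qed


section \<open>Real stability functions\<close>

lemma abs_douglas_le_one:
  fixes p w :: real
  assumes "p > 0" "0 \<le> w" "w \<le> 2 * p"
  shows "\<bar>1 - w / p\<bar> \<le> 1"
  using assms by (simp add: abs_le_iff field_simps)

text \<open>
  With \<open>b = z0 / p \<ge> -2\<close> and \<open>c = 2 - S / p \<ge> 0\<close>, the value of the stability function is
  \<open>((2 + b) * c + b\<^sup>2) / 2 - 1\<close>, which is at least \<open>-1\<close>. It also equals
  \<open>1 - (w / p) * (2 + b) / 2\<close>, which is at most \<open>1\<close>.
\<close>

lemma abs_craig_sneyd_le_one:
  fixes p w z0 S :: real
  assumes p: "p > 0" and w: "w = S - z0" "0 \<le> w" and S: "S \<le> 2 * p" and z0: "- 2 * p \<le> z0"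
  shows "\<bar>1 - w / p - z0 / p * (w / p) / 2\<bar> \<le> 1"
proof -
  define b c where "b = z0 / p" and "c = 2 - S / p"
  have wp: "w / p = 2 - c - b" using w(1) by (simp add: b_def c_def diff_divide_distrib)
  have a: "0 \<le> 2 - c - b" using p w unfolding wp[symmetric] by simp
  have b: "0 \<le> 2 + b" and c: "0 \<le> c" using p z0 S by (simp_all add: b_def c_def field_simps)
  define N where "N = 2 * c + b * c + b\<^sup>2"
  have "N = (2 + b) * c + b\<^sup>2" by (simp add: N_def algebra_simps)
  then have N0: "0 \<le> N" using b c by simp
  have "4 - N = (2 - c - b) * (2 + b)"
    by (simp add: N_def power2_eq_square algebra_simps)
  then have N4: "N \<le> 4" using mult_nonneg_nonneg[OF a b] by linarith
  have M: "1 - (2 - c - b) - b * (2 - c - b) / 2 = N / 2 - 1"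
    by (simp add: N_def power2_eq_square field_simps)
  show ?thesis
    unfolding wp b_def[symmetric] M using N0 N4 by (simp add: abs_le_iff)
qed

text \<open>
  In the remaining two schemes \<open>M = 1 - a * s + a\<^sup>2 / 2\<close> with \<open>a = w / p\<close> is a quadratic polynomial
  that takes the value \<open>1\<close> at \<open>a = 0\<close> and \<open>a = 2 * s\<close> and whose minimum \<open>1 - s\<^sup>2 / 2\<close> is at least
  \<open>-1\<close> since \<open>0 \<le> s \<le> 2\<close>.
\<close>

lemma abs_quadratic_le_one:
  fixes a s :: real
  assumes a: "0 \<le> a" "a \<le> 2 * s" and s: "s \<le> 2"
  shows "\<bar>1 - a * s + a\<^sup>2 / 2\<bar> \<le> 1"
proof -
  have "0 \<le> a * (2 * s - a)" using a by simp
  moreover have "s * s \<le> 2 * 2" using a s by (intro mult_mono) auto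
  moreover have "0 \<le> (a - s)\<^sup>2" by simp
  ultimately show ?thesis by (simp add: abs_le_iff power2_eq_square algebra_simps)
qed

lemma abs_modified_craig_sneyd_le_one:
  fixes p w R :: real
  assumes p: "p > 0" and R: "R \<le> p" and w: "0 \<le> w" "w \<le> 2 * p + 2 * R"
  shows "\<bar>1 - w / p - R / p * (w / p) + (w / p)\<^sup>2 / 2\<bar> \<le> 1"
proof -
  have "\<bar>1 - w / p * (1 + R / p) + (w / p)\<^sup>2 / 2\<bar> \<le> 1"
    by (rule abs_quadratic_le_one) (use assms in \<open>simp_all add: field_simps\<close>)
  then show ?thesis by (simp add: algebra_simps)
qed

lemma abs_hundsdorfer_verwer_le_one:
  fixes p w :: real
  assumes p: "p > 0" and w: "0 \<le> w" "w \<le> 4 * p - 2"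
  shows "\<bar>1 - 2 * (w / p) + w / p * (1 / p) + (w / p)\<^sup>2 / 2\<bar> \<le> 1"
proof -
  have "\<bar>1 - w / p * (2 - 1 / p) + (w / p)\<^sup>2 / 2\<bar> \<le> 1"
    by (rule abs_quadratic_le_one) (use assms in \<open>simp_all add: field_simps\<close>)
  then show ?thesis by (simp add: algebra_simps)
qed

lemma stability_function_real:
  fixes x :: "'n::finite \<Rightarrow> real" and z0 \<theta> :: real
  defines "S \<equiv> \<Sum>j\<in>UNIV. (x j)\<^sup>2" and "p \<equiv> \<Prod>j\<in>UNIV. 1 + \<theta> * (x j)\<^sup>2"
  shows "stability_function sch \<theta> (of_real z0) (\<lambda>j. of_real (- (x j)\<^sup>2)) = of_real
    (case sch of
       Douglas \<Rightarrow> 1 - (S - z0) / p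
     | Craig_Sneyd \<Rightarrow> 1 - (S - z0) / p - z0 / p * ((S - z0) / p) / 2
     | Modified_Craig_Sneyd \<Rightarrow>
         1 - (S - z0) / p - \<theta> * S / p * ((S - z0) / p) + ((S - z0) / p)\<^sup>2 / 2
     | Hundsdorfer_Verwer \<Rightarrow>
         1 - 2 * ((S - z0) / p) + (S - z0) / p * (1 / p) + ((S - z0) / p)\<^sup>2 / 2)"
proof -
  have S: "(\<Sum>j\<in>UNIV. complex_of_real (- (x j)\<^sup>2)) = - of_real S"
    by (simp add: S_def sum_negf)
  have p: "(\<Prod>j\<in>UNIV. 1 - complex_of_real \<theta> * of_real (- (x j)\<^sup>2)) = of_real p"
    by (simp add: p_def)
  \<comment> \<open>after this abstraction the four identities are polynomial in \<open>q\<close>, \<open>z\<close>, \<open>s\<close> and \<open>t\<close>\<close>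
  define q z s t where "q = inverse (complex_of_real p)" and "z = complex_of_real z0"
    and "s = complex_of_real S" and "t = complex_of_real \<theta>"
  note atoms = q_def[symmetric] z_def[symmetric] s_def[symmetric] t_def[symmetric]
  show ?thesis
    unfolding stability_function_def Let_def S p
    by (cases sch; simp only: adi_scheme.case of_real_add of_real_diff of_real_mult of_real_divide
        of_real_power of_real_1 of_real_numeral of_real_inverse divide_inverse power2_eq_square
        inverse_mult_distrib atoms;
      simp add: algebra_simps)
qed

text \<open>
  Two and three directions differ only in the constants of the bounds on \<open>p\<close> and \<open>T\<close>, which are
  \<open>K = 1\<close>, \<open>\<kappa>1 = 1\<close>, \<open>\<kappa>2 = sqrt 2 / 2\<close> and \<open>K = 2\<close>, \<open>\<kappa>1 = 5/8\<close>, \<open>\<kappa>2 = sqrt 3 / 4\<close>. With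
  \<open>w \<le> S + \<gamma> * T\<close> the sufficient condition of each of the Douglas, modified Craig-Sneyd and
  Hundsdorfer-Verwer schemes has the form \<open>\<gamma> * T \<le> c * S + d * T\<close>, where \<open>c \<ge> 0\<close>, and follows
  from \<open>\<gamma> \<le> c / K + d\<close> since \<open>S \<ge> T / K\<close>.
\<close>

lemma stability_from_factor_bounds:
  fixes x :: "'n::finite \<Rightarrow> real" and z0 \<theta> \<gamma> \<kappa>1 \<kappa>2 K :: real
  defines "S \<equiv> \<Sum>j\<in>UNIV. (x j)\<^sup>2" and "p \<equiv> \<Prod>j\<in>UNIV. 1 + \<theta> * (x j)\<^sup>2"
    and "T \<equiv> \<Sum>i\<in>UNIV. \<Sum>j\<in>UNIV - {i}. x i * x j"
  assumes x: "\<And>j. x j \<ge> 0" and \<theta>: "\<theta> > 0" and \<gamma>: "\<gamma> \<le> 1"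
    and z0S: "z0 \<le> S" and z0T: "\<bar>z0\<bar> \<le> \<gamma> * T"
    and K: "K > 0" "T \<le> K * S"
    and \<kappa>1: "\<theta> * S + \<kappa>1 * \<theta> * T \<le> p" and \<kappa>2: "1/2 + \<theta> * S + \<kappa>2 * \<theta> * T \<le> p"
  shows "\<theta> \<ge> 1/2 \<Longrightarrow> \<gamma> \<le> (2 * \<theta> - 1) / K + 2 * \<kappa>1 * \<theta> \<Longrightarrow>
      cmod (stability_function Douglas \<theta> (of_real z0) (\<lambda>j. of_real (- (x j)\<^sup>2))) \<le> 1"
      (is "_ \<Longrightarrow> _ \<Longrightarrow> ?Do")
    and "\<theta> \<ge> 1/2 \<Longrightarrow> 1 / K + \<kappa>1 \<ge> 1 \<Longrightarrow>
      cmod (stability_function Craig_Sneyd \<theta> (of_real z0) (\<lambda>j. of_real (- (x j)\<^sup>2))) \<le> 1"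
      (is "_ \<Longrightarrow> _ \<Longrightarrow> ?CS")
    and "\<theta> \<ge> 1/4 \<Longrightarrow> \<gamma> \<le> (4 * \<theta> - 1) / K + 2 * \<kappa>1 * \<theta> \<Longrightarrow>
      cmod (stability_function Modified_Craig_Sneyd \<theta> (of_real z0) (\<lambda>j. of_real (- (x j)\<^sup>2))) \<le> 1"
      (is "_ \<Longrightarrow> _ \<Longrightarrow> ?MCS")
    and "\<theta> \<ge> 1/4 \<Longrightarrow> \<gamma> \<le> (4 * \<theta> - 1) / K + 4 * \<kappa>2 * \<theta> \<Longrightarrow>
      cmod (stability_function Hundsdorfer_Verwer \<theta> (of_real z0) (\<lambda>j. of_real (- (x j)\<^sup>2))) \<le> 1"
      (is "_ \<Longrightarrow> _ \<Longrightarrow> ?HV")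
proof -
  have p1: "1 + \<theta> * S \<le> p"
    unfolding p_def S_def by (rule one_plus_sum_le_implicit_factor) (use \<theta> in simp)
  have S0: "S \<ge> 0" by (simp add: S_def sum_nonneg)
  have T0: "T \<ge> 0" unfolding T_def using x by (intro sum_nonneg) simp
  have p0: "p > 0" using p1 S0 \<theta> by (smt (verit) mult_nonneg_nonneg)
  have w0: "0 \<le> S - z0" using z0S by simp
  have w: "S - z0 \<le> S + \<gamma> * T" using z0T by linarith
  note M = stability_function_real[where x = x and \<theta> = \<theta> and ?z0.0 = z0,
      folded S_def p_def]
  note M = M[where sch = Douglas, simplified adi_scheme.case]
    M[where sch = Craig_Sneyd, simplified adi_scheme.case]
    M[where sch = Modified_Craig_Sneyd, simplified adi_scheme.case]
    M[where sch = Hundsdorfer_Verwer, simplified adi_scheme.case]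
  have TS: "\<gamma> * T \<le> c * S + d * T" if "\<gamma> \<le> c / K + d" "c \<ge> 0" for c d
  proof -
    have "\<gamma> * T \<le> (c / K + d) * T" using that(1) T0 by (rule mult_right_mono)
    also have "c / K * T \<le> c / K * (K * S)" using that(2) K by (intro mult_left_mono) auto
    then have "(c / K + d) * T \<le> c * S + d * T" using K(1) by (simp add: distrib_right)
    finally show ?thesis .
  qed
  show ?Do if "\<theta> \<ge> 1/2" "\<gamma> \<le> (2 * \<theta> - 1) / K + 2 * \<kappa>1 * \<theta>"
    unfolding M norm_of_real
  proof (rule abs_douglas_le_one[OF p0 w0])
    show "S - z0 \<le> 2 * p"
      using w TS[OF that(2)] that(1) \<kappa>1 by (simp add: algebra_simps)
  qed
  show ?CS if "\<theta> \<ge> 1/2" "1 / K + \<kappa>1 \<ge> 1"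
    unfolding M norm_of_real
  proof (rule abs_craig_sneyd_le_one[OF p0 refl w0])
    have "1/2 * S \<le> \<theta> * S" using that(1) S0 by (rule mult_right_mono)
    then show "S \<le> 2 * p" using p1 by simp
    have "1 * T \<le> (1 / K + \<kappa>1) * T" using that(2) T0 by (rule mult_right_mono)
    moreover have "T / K \<le> S" using K by (simp add: field_simps)
    ultimately have "T \<le> S + \<kappa>1 * T" by (simp add: distrib_right)
    then have "\<theta> * T \<le> \<theta> * (S + \<kappa>1 * T)" using \<theta> by (simp add: mult_left_mono)
    also have "\<dots> \<le> p" using \<kappa>1 by (simp add: algebra_simps)
    finally have "\<theta> * T \<le> p" .
    moreover have "1/2 * T \<le> \<theta> * T" using that(1) T0 by (rule mult_right_mono)
    moreover have "\<gamma> * T \<le> 1 * T" using \<gamma> T0 by (rule mult_right_mono)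
    ultimately show "- 2 * p \<le> z0" using z0T by linarith
  qed
  show ?MCS if "\<theta> \<ge> 1/4" "\<gamma> \<le> (4 * \<theta> - 1) / K + 2 * \<kappa>1 * \<theta>"
    unfolding M norm_of_real
  proof (rule abs_modified_craig_sneyd_le_one[OF p0 _ w0])
    show "\<theta> * S \<le> p" using p1 by simp
    show "S - z0 \<le> 2 * p + 2 * (\<theta> * S)"
      using w TS[OF that(2)] that(1) \<kappa>1 by (simp add: algebra_simps)
  qed
  show ?HV if "\<theta> \<ge> 1/4" "\<gamma> \<le> (4 * \<theta> - 1) / K + 4 * \<kappa>2 * \<theta>"
    unfolding M norm_of_real
  proof (rule abs_hundsdorfer_verwer_le_one[OF p0 w0])
    show "S - z0 \<le> 4 * p - 2"
      using w TS[OF that(2)] that(1) \<kappa>2 by (simp add: algebra_simps)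
  qed
qed


section \<open>Unconditional stability\<close>

theorem theorem3:
  fixes D \<beta> :: "real^'n^'n" and \<gamma> \<theta> :: real
  assumes k: "CARD('n) = 2 \<or> CARD('n) = 3"
    and D_sym: "transpose D = D" and D_psd: "psd D"
    and \<gamma>: "0 \<le> \<gamma>" "\<gamma> \<le> 1"
    and D_\<gamma>: "\<And>i j. i \<noteq> j \<Longrightarrow> \<bar>D $ i $ j\<bar> \<le> \<gamma> * sqrt (D $ i $ i * D $ j $ j)"
    and \<beta>_sym: "\<And>i j. i \<noteq> j \<Longrightarrow> \<beta> $ i $ j = \<beta> $ j $ i" and \<beta>_diag: "\<And>i. \<beta> $ i $ i = -1"
    and B_psd: "psd (- \<beta>)"
    and \<theta>: "\<theta> > 0"
  shows
    "((CARD('n) = 2 \<and> \<theta> \<ge> 1/2) \<or>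
      (CARD('n) = 3 \<and> \<theta> \<ge> max (1/2) (2 * (2 * \<gamma> + 1) / 9)) \<longrightarrow>
        unconditionally_stable Douglas \<theta> D \<beta>)
   \<and> (\<theta> \<ge> 1/2 \<longrightarrow>
        unconditionally_stable Craig_Sneyd \<theta> D \<beta>)
   \<and> ((CARD('n) = 2 \<and> \<theta> \<ge> max (1/4) ((\<gamma> + 1) / 6)) \<or>
      (CARD('n) = 3 \<and> \<theta> \<ge> max (1/4) (2 * (2 * \<gamma> + 1) / 13)) \<longrightarrow>
        unconditionally_stable Modified_Craig_Sneyd \<theta> D \<beta>)
   \<and> ((CARD('n) = 2 \<and> \<theta> \<ge> max (1/4) ((\<gamma> + 1) / (4 + 2 * sqrt 2))) \<or>
      (CARD('n) = 3 \<and> \<theta> \<ge> max (1/4) ((2 * \<gamma> + 1) / (4 + 2 * sqrt 3))) \<longrightarrow>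
        unconditionally_stable Hundsdorfer_Verwer \<theta> D \<beta>)"
proof -
  have reduce: "(\<theta> \<ge> 1/2 \<longrightarrow> \<gamma> \<le> (2 * \<theta> - 1) / K + 2 * \<kappa>1 * \<theta> \<longrightarrow>
        unconditionally_stable Douglas \<theta> D \<beta>) \<and>
      (\<theta> \<ge> 1/2 \<longrightarrow> 1 / K + \<kappa>1 \<ge> 1 \<longrightarrow> unconditionally_stable Craig_Sneyd \<theta> D \<beta>) \<and>
      (\<theta> \<ge> 1/4 \<longrightarrow> \<gamma> \<le> (4 * \<theta> - 1) / K + 2 * \<kappa>1 * \<theta> \<longrightarrow>
        unconditionally_stable Modified_Craig_Sneyd \<theta> D \<beta>) \<and>
      (\<theta> \<ge> 1/4 \<longrightarrow> \<gamma> \<le> (4 * \<theta> - 1) / K + 4 * \<kappa>2 * \<theta> \<longrightarrow>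
        unconditionally_stable Hundsdorfer_Verwer \<theta> D \<beta>)"
    if K: "K > 0"
      "\<And>x :: 'n \<Rightarrow> real. (\<Sum>i\<in>UNIV. \<Sum>j\<in>UNIV - {i}. x i * x j) \<le> K * (\<Sum>j\<in>UNIV. (x j)\<^sup>2)"
    and \<kappa>1: "\<And>x :: 'n \<Rightarrow> real. (\<forall>j. x j \<ge> 0) \<longrightarrow> \<theta> * (\<Sum>j\<in>UNIV. (x j)\<^sup>2)
        + \<kappa>1 * \<theta> * (\<Sum>i\<in>UNIV. \<Sum>j\<in>UNIV - {i}. x i * x j) \<le> (\<Prod>j\<in>UNIV. 1 + \<theta> * (x j)\<^sup>2)"
    and \<kappa>2: "\<And>x :: 'n \<Rightarrow> real. (\<forall>j. x j \<ge> 0) \<longrightarrow> 1/2 + \<theta> * (\<Sum>j\<in>UNIV. (x j)\<^sup>2)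
        + \<kappa>2 * \<theta> * (\<Sum>i\<in>UNIV. \<Sum>j\<in>UNIV - {i}. x i * x j) \<le> (\<Prod>j\<in>UNIV. 1 + \<theta> * (x j)\<^sup>2)"
    for K \<kappa>1 \<kappa>2
  proof -
    have stable: "cmod (stability_function sch \<theta> (of_real (scaled_eigenvalue_mixed D \<beta> \<Delta>t h \<phi>))
        (\<lambda>j. of_real (scaled_eigenvalue_dir D \<Delta>t h \<phi> j))) \<le> 1"
      if \<Delta>t: "\<Delta>t > 0" and h: "\<forall>i. h $ i > 0"
      and sch: "case sch of
          Douglas \<Rightarrow> \<theta> \<ge> 1/2 \<and> \<gamma> \<le> (2 * \<theta> - 1) / K + 2 * \<kappa>1 * \<theta>
        | Craig_Sneyd \<Rightarrow> \<theta> \<ge> 1/2 \<and> 1 / K + \<kappa>1 \<ge> 1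
        | Modified_Craig_Sneyd \<Rightarrow> \<theta> \<ge> 1/4 \<and> \<gamma> \<le> (4 * \<theta> - 1) / K + 2 * \<kappa>1 * \<theta>
        | Hundsdorfer_Verwer \<Rightarrow> \<theta> \<ge> 1/4 \<and> \<gamma> \<le> (4 * \<theta> - 1) / K + 4 * \<kappa>2 * \<theta>"
      for sch \<Delta>t and h :: "real^'n" and \<phi>
    proof -
      define x where "x j = sqrt (- scaled_eigenvalue_dir D \<Delta>t h \<phi> j)" for j
      have x: "x j \<ge> 0" for j
        using \<Delta>t h psd_diagonal_nonneg[OF D_psd, of j]
        by (simp add: x_def scaled_eigenvalue_dir_def less_imp_le)
      let ?M = "\<lambda>sch. stability_function sch \<theta> (of_real (scaled_eigenvalue_mixed D \<beta> \<Delta>t h \<phi>))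
        (\<lambda>j. of_real (- (x j)\<^sup>2))"
      note eigenvalue_bounds = scaled_eigenvalue_bounds[where \<phi> = \<phi> and h = h and \<gamma> = \<gamma>,
          OF D_sym D_psd _ _ \<beta>_diag B_psd \<Delta>t h[rule_format], folded x_def]
      have dir: "scaled_eigenvalue_dir D \<Delta>t h \<phi> j = - (x j)\<^sup>2" for j
        by (rule eigenvalue_bounds(1)) (simp_all add: D_\<gamma> \<beta>_sym)
      have mixed: "scaled_eigenvalue_mixed D \<beta> \<Delta>t h \<phi> \<le> (\<Sum>j\<in>UNIV. (x j)\<^sup>2)"
        by (rule eigenvalue_bounds(2)) (simp_all add: D_\<gamma> \<beta>_sym)
      have abs_mixed: "\<bar>scaled_eigenvalue_mixed D \<beta> \<Delta>t h \<phi>\<bar>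
          \<le> \<gamma> * (\<Sum>i\<in>UNIV. \<Sum>j\<in>UNIV - {i}. x i * x j)"
        by (rule eigenvalue_bounds(3)) (simp_all add: D_\<gamma> \<beta>_sym)
      note stable = stability_from_factor_bounds[where x = x,
          OF x \<theta> \<gamma>(2) mixed abs_mixed K \<kappa>1[rule_format, OF x] \<kappa>2[rule_format, OF x]]
      have "cmod (?M sch) \<le> 1"
      proof (cases sch)
        case Douglas
        then show ?thesis using sch stable(1) by (simp only: adi_scheme.case)
      next
        case Craig_Sneyd
        then show ?thesis using sch stable(2) by (simp only: adi_scheme.case)
      next
        case Modified_Craig_Sneyd
        then show ?thesis using sch stable(3) by (simp only: adi_scheme.case)
      next
        case Hundsdorfer_Verwer
        then show ?thesis using sch stable(4) by (simp only: adi_scheme.case)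
      qed
      then show ?thesis unfolding dir .
    qed
    show ?thesis
      unfolding unconditionally_stable_iff
    proof (intro conjI impI allI, goal_cases)
      case 1 show ?case by (rule stable) (use 1 in simp_all)
    next
      case 2 show ?case by (rule stable) (use 2 in simp_all)
    next
      case 3 show ?case by (rule stable) (use 3 in simp_all)
    next
      case 4 show ?case by (rule stable) (use 4 in simp_all)
    qed
  qed
  show ?thesis
  proof (cases "CARD('n) = 2")
    case True
    have K: "(\<Sum>i\<in>UNIV. \<Sum>j\<in>UNIV - {i}. x i * x j) \<le> 1 * (\<Sum>j\<in>UNIV. (x j)\<^sup>2)"
      for x :: "'n \<Rightarrow> real"
      using offdiagonal_sum_le_two[OF True, of x] by simp
    note r = implicit_factor_lower_bound_two[OF True, where \<theta> = \<theta>]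
    have r1: "\<theta> * (\<Sum>j\<in>UNIV. (x j)\<^sup>2) + 1 * \<theta> * (\<Sum>i\<in>UNIV. \<Sum>j\<in>UNIV - {i}. x i * x j)
        \<le> (\<Prod>j\<in>UNIV. 1 + \<theta> * (x j)\<^sup>2)" for x :: "'n \<Rightarrow> real"
      using r[of 1 x] by simp
    have r2: "1/2 + \<theta> * (\<Sum>j\<in>UNIV. (x j)\<^sup>2)
        + (sqrt 2 / 2) * \<theta> * (\<Sum>i\<in>UNIV. \<Sum>j\<in>UNIV - {i}. x i * x j)
        \<le> (\<Prod>j\<in>UNIV. 1 + \<theta> * (x j)\<^sup>2)" for x :: "'n \<Rightarrow> real"
      using r[of "sqrt 2 / 2" x] by (simp add: power_divide)
    have s: "(\<gamma> + 1) / (4 + 2 * sqrt 2) \<le> \<theta> \<Longrightarrow> \<gamma> \<le> (4 * \<theta> - 1) / 1 + 4 * (sqrt 2 / 2) * \<theta>"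
      by (subst (asm) pos_divide_le_eq) (simp_all add: add_pos_pos algebra_simps)
    note stable = reduce[OF zero_less_one K impI[OF r1] impI[OF r2]]
    show ?thesis
    proof (intro conjI impI, goal_cases)
      case 1
      then show ?case using stable True \<gamma> by (simp add: field_simps)
    next
      case 2
      then show ?case using stable by simp
    next
      case 3
      then show ?case using stable True \<gamma> by (simp add: field_simps)
    next
      case 4
      then show ?case using stable True \<gamma> s by simp
    qed
  next
    case False
    then have card: "CARD('n) = 3" using k by simp
    note r = implicit_factor_lower_bound_three[OF card _ less_imp_le[OF \<theta>]]
    have r1: "\<theta> * (\<Sum>j\<in>UNIV. (x j)\<^sup>2) + (5/8) * \<theta> * (\<Sum>i\<in>UNIV. \<Sum>j\<in>UNIV - {i}. x i * x j)
        \<le> (\<Prod>j\<in>UNIV. 1 + \<theta> * (x j)\<^sup>2)" if "\<forall>j. x j \<ge> 0" for x :: "'n \<Rightarrow> real"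
      using r[of x "1/2"] that by (simp add: power2_eq_square power3_eq_cube)
    have r2: "1/2 + \<theta> * (\<Sum>j\<in>UNIV. (x j)\<^sup>2)
        + (sqrt 3 / 4) * \<theta> * (\<Sum>i\<in>UNIV. \<Sum>j\<in>UNIV - {i}. x i * x j)
        \<le> (\<Prod>j\<in>UNIV. 1 + \<theta> * (x j)\<^sup>2)" if "\<forall>j. x j \<ge> 0" for x :: "'n \<Rightarrow> real"
    proof -
      define \<rho> :: real where "\<rho> = (sqrt 3 - 1) / 2"
      have "sqrt 3 \<le> 2" by (rule real_le_lsqrt) simp_all
      then have \<rho>: "0 \<le> \<rho>" "\<rho> \<le> 1" by (simp_all add: \<rho>_def)
      \<comment> \<open>\<open>\<rho>\<close> is the nonnegative root of \<open>3 * \<rho>\<^sup>2 + 2 * \<rho> ^ 3 = 1/2\<close>\<close>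
      have \<rho>2: "\<rho>\<^sup>2 = 1 - sqrt 3 / 2" by (simp add: \<rho>_def power2_eq_square field_simps)
      have "\<rho> ^ 3 = \<rho>\<^sup>2 * \<rho>" by (simp add: power2_eq_square power3_eq_cube)
      also have "\<dots> = (3 * sqrt 3 - 5) / 4" unfolding \<rho>2 by (simp add: \<rho>_def field_simps)
      finally have \<rho>3: "3 * \<rho>\<^sup>2 + 2 * \<rho> ^ 3 = 1/2" unfolding \<rho>2 by simp
      have \<kappa>: "\<rho> + \<rho>\<^sup>2 / 2 = sqrt 3 / 4" unfolding \<rho>2 by (simp add: \<rho>_def field_simps)
      show ?thesis using r[of x \<rho>, OF that[rule_format] \<rho>] unfolding \<rho>3 \<kappa> by simp
    qed
    have s: "(2 * \<gamma> + 1) / (4 + 2 * sqrt 3) \<le> \<theta> \<Longrightarrow> \<gamma> \<le> (4 * \<theta> - 1) / 2 + 4 * (sqrt 3 / 4) * \<theta>"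
      by (subst (asm) pos_divide_le_eq) (simp_all add: add_pos_pos field_simps)
    note stable = reduce[OF zero_less_numeral offdiagonal_sum_le_three[OF card] impI[OF r1] impI[OF r2]]
    show ?thesis
    proof (intro conjI impI, goal_cases)
      case 1
      then show ?case using stable card by (simp add: field_simps)
    next
      case 2
      then show ?case using stable by simp
    next
      case 3
      then show ?case using stable card by (simp add: field_simps)
    next
      case 4
      then show ?case using stable card s by simp
    qed
  qed
qed

end
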